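(* Let $u_1=u_1(t_1,\dots,t_g)$, $t_1=x$, be a function near $t=0$ which is a solution of the stationary $g$-KdV equation with respect to $x$, in the following sense: $u_1=v_1$ is the first member of a sequence $v_1,\dots,v_g$ of functions near $t=0$ whose generating function $\mathbf v(\xi)=\sum_{i=1}^gv_i\xi^i$ satisfies $$\mathbf v'''(\xi)+2v_1'(2-\mathbf v(\xi))-4(\xi^{-1}+v_1)\mathbf v'(\xi)=0,$$ $$\partial_k\mathbf v(\xi)=D_k(2-\mathbf v(\xi))\mathbf v'(\xi)-D_k(\mathbf v'(\xi))(2-\mathbf v(\xi)),\quad 1\le k\le g.$$ Then there exists a differentiable solution $w$ near $t=0$ of $$2\partial_x^2\log w=-u_1,\qquad w(0)=1,\quad\partial_kw(0)=0\ (k=1,\dots,g),$$ such that for the functions $u_k=-2\,\partial_x\partial_k\log w$, $k=1,\dots,g$, the operators $$\mathcal L=\partial_x^2-u_1,\qquad \mathcal U_i=\partial_x^2\partial_i-\tfrac12(u_1\partial_i+\partial_iu_1)-\tfrac14(u_i\partial_x+\partial_xu_i)-\partial_{i+1},\quad 1\le i\le g,$$ commute pairwise, and $\mathbf u(\xi)=\sum_{i=1}^gu_i\xi^i$ satisfies $$4\Bigl(4\xi^{-1}+\sum_{i=1}^{2g}\mu_i\xi^i\Bigr)=\mathbf u'(\xi)^2+2\mathbf u''(\xi)(2-\mathbf u(\xi))+4(\xi^{-1}+u_1)(2-\mathbf u(\xi))^2$$ for some constants $\mu_1,\dots,\mu_{2g}$.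
   Context: Prime denotes $\partial_x=\partial/\partial t_1$; $\partial_i=\partial/\partial t_i$ for $1\le i\le g$ and $\partial_{g+1}:=0$. In operator formulas functions denote multiplication operators and products are compositions of operators. For a polynomial $f(\xi)=\sum_{j\ge0}f_j\xi^j$, $(D_kf)(\xi)=\frac12\sum_{j=0}^{k-1}f_j\xi^{j-k+1}$. Derivatives of generating functions are taken coefficientwise. *)

theory Defs
  imports
    "HOL-Analysis.Analysis"
    "HOL-Computational_Algebra.Formal_Laurent_Series"
begin

text \<open>
  Scalars range over a type of class \<^class>\<open>real_normed_field\<close> (the real and the complex
  numbers).  The variables (t_1, ..., t_g) form a vector of type 'a ^ 'n with g = CARD('n);
  a bijection e from {1..CARD('n)} to the index type says which coordinate is t_i.
\<close>

definition partial_deriv :: "'n::finite \<Rightarrow> ('a::real_normed_field ^ 'n \<Rightarrow> 'a) \<Rightarrow> 'a ^ 'n \<Rightarrow> 'a" where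
  "partial_deriv j f t = deriv (\<lambda>s. f (t + axis j s)) 0"

text \<open>Derivatives are taken over the field 'a itself.  So on an open set the notion of smoothness
  below is C-infinity over the reals, and holomorphy over the complex numbers.\<close>

primrec C_k_on :: "nat \<Rightarrow> ('a::real_normed_field ^ 'n::finite) set \<Rightarrow> ('a ^ 'n \<Rightarrow> 'a) \<Rightarrow> bool" where
  "C_k_on 0 S f \<longleftrightarrow> continuous_on S f"
| "C_k_on (Suc k) S f \<longleftrightarrow> continuous_on S f \<and>
     (\<forall>j. (\<forall>t\<in>S. (\<lambda>s. f (t + axis j s)) field_differentiable (at 0)) \<and>
          C_k_on k S (partial_deriv j f))"

definition smooth_fun_on :: "('a::real_normed_field ^ 'n::finite) set \<Rightarrow> ('a ^ 'n \<Rightarrow> 'a) \<Rightarrow> bool" where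
  "smooth_fun_on S f \<longleftrightarrow> (\<forall>k. C_k_on k S f)"

text \<open>The derivative with respect to t_i; the convention that it vanishes for i = g + 1 is the
  second branch.\<close>

definition pd :: "(nat \<Rightarrow> 'n::finite) \<Rightarrow> nat \<Rightarrow> ('a::real_normed_field ^ 'n \<Rightarrow> 'a) \<Rightarrow> 'a ^ 'n \<Rightarrow> 'a" where
  "pd e i f = (if i \<in> {1..CARD('n)} then partial_deriv (e i) f else (\<lambda>t. 0))"

text \<open>Generating functions are Laurent series in the formal variable \<^term>\<open>fls_X\<close>.  The argument
  c is the sequence of coefficient functions, so a coefficientwise derivative is obtained by
  differentiating each c i.\<close>

definition gen_fun :: "(nat \<Rightarrow> 'a::real_normed_field ^ 'n::finite \<Rightarrow> 'a) \<Rightarrow> 'a ^ 'n \<Rightarrow> 'a fls" where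
  "gen_fun c t = (\<Sum>i=1..CARD('n). fls_const (c i t) * fls_X ^ i)"

definition D_op :: "nat \<Rightarrow> 'a::field fls \<Rightarrow> 'a fls" where
  "D_op k f = fls_const (1/2) *
     (\<Sum>j<k. fls_const (fls_nth f (int j)) * fls_X_intpow (int j - int k + 1))"

definition stationary_gKdV ::
  "(nat \<Rightarrow> 'n::finite) \<Rightarrow> ('a::real_normed_field ^ 'n) set \<Rightarrow> ('a ^ 'n \<Rightarrow> 'a) \<Rightarrow> bool" where
  "stationary_gKdV e S u1 \<longleftrightarrow> (\<exists>v.
     (\<forall>i\<in>{1..CARD('n)}. smooth_fun_on S (v i)) \<and>
     (\<forall>t\<in>S. u1 t = v 1 t) \<and>
     (\<forall>t\<in>S.
        gen_fun (\<lambda>i. pd e 1 (pd e 1 (pd e 1 (v i)))) t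
        + 2 * fls_const (pd e 1 (v 1) t) * (2 - gen_fun v t)
        - 4 * (fls_X_inv + fls_const (v 1 t)) * gen_fun (\<lambda>i. pd e 1 (v i)) t = 0) \<and>
     (\<forall>k\<in>{1..CARD('n)}. \<forall>t\<in>S.
        gen_fun (\<lambda>i. pd e k (v i)) t =
          D_op k (2 - gen_fun v t) * gen_fun (\<lambda>i. pd e 1 (v i)) t
          - D_op k (gen_fun (\<lambda>i. pd e 1 (v i)) t) * (2 - gen_fun v t)))"

definition log_branch_on ::
  "('a::{real_normed_field, banach} ^ 'n::finite) set \<Rightarrow> ('a ^ 'n \<Rightarrow> 'a) \<Rightarrow> ('a ^ 'n \<Rightarrow> 'a) \<Rightarrow> bool" where
  "log_branch_on S w l \<longleftrightarrow> smooth_fun_on S l \<and> (\<forall>t\<in>S. exp (l t) = w t)"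

text \<open>Differential operators act on functions; a product of a multiplication operator and a
  derivative, as in the summands of the second operator, is their composition.\<close>

definition L_op ::
  "(nat \<Rightarrow> 'n::finite) \<Rightarrow> (nat \<Rightarrow> 'a::real_normed_field ^ 'n \<Rightarrow> 'a)
     \<Rightarrow> ('a ^ 'n \<Rightarrow> 'a) \<Rightarrow> 'a ^ 'n \<Rightarrow> 'a" where
  "L_op e u f = (\<lambda>t. pd e 1 (pd e 1 f) t - u 1 t * f t)"

definition U_op ::
  "(nat \<Rightarrow> 'n::finite) \<Rightarrow> (nat \<Rightarrow> 'a::real_normed_field ^ 'n \<Rightarrow> 'a) \<Rightarrow> nat
     \<Rightarrow> ('a ^ 'n \<Rightarrow> 'a) \<Rightarrow> 'a ^ 'n \<Rightarrow> 'a" where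
  "U_op e u i f = (\<lambda>t.
     pd e 1 (pd e 1 (pd e i f)) t
     - 1/2 * (u 1 t * pd e i f t + pd e i (\<lambda>s. u 1 s * f s) t)
     - 1/4 * (u i t * pd e 1 f t + pd e 1 (\<lambda>s. u i s * f s) t)
     - pd e (i + 1) f t)"

definition ops_commute_on ::
  "('a::real_normed_field ^ 'n::finite) set \<Rightarrow> (('a ^ 'n \<Rightarrow> 'a) \<Rightarrow> 'a ^ 'n \<Rightarrow> 'a)
     \<Rightarrow> (('a ^ 'n \<Rightarrow> 'a) \<Rightarrow> 'a ^ 'n \<Rightarrow> 'a) \<Rightarrow> bool" where
  "ops_commute_on S P Q \<longleftrightarrow> (\<forall>f. smooth_fun_on S f \<longrightarrow> (\<forall>t\<in>S. P (Q f) t = Q (P f) t))"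

end

theory Submission
  imports Defs "HOL-Library.Function_Algebras"
begin

unbundle no fps_syntax

text \<open>
  Write W = 2 - v for the generating function.  The coefficients of the flow equation are partial
  sums of an antisymmetric expression in the w_j, which gives both the symmetry
  \<open>\<partial>\<^sub>i v\<^sub>k = \<partial>\<^sub>k v\<^sub>i\<close> and a closed form of
  \<open>\<partial>\<^bsub>i+1\<^esub> v\<^sub>j - \<partial>\<^bsub>j+1\<^esub> v\<^sub>i\<close>; together with the x-recursion these are all the
  relations that the commutators need.  The symmetry makes \<open>- v\<^sub>k / 2\<close> the gradient of a function p
  with p(0) = 0 on a ball around 0, and integrating p in x alone gives log w; no further condition on
  the mixed second derivatives of log w is needed.  The right-hand side Q of the final identity is
  constant in x by the third-order equation.  For the other variables, multiplying by powers of
  the formal variable turns the flow into \<open>2 \<xi>\<^bsup>k-1\<^esup> \<partial>\<^sub>k W = P W' - P' W\<close> with P the truncation of W,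
  and P satisfies the recursion of W up to a single boundary term, which is cancelled by \<open>\<partial>\<^sub>k v\<^sub>1\<close>.
\<close>

section \<open>Smooth functions of several variables\<close>

lemma axis_add: "axis j (x + y) = axis j x + axis j (y::'a::real_normed_field)"
  by (simp add: vec_eq_iff axis_def)

lemma axis_zero [simp]: "axis j (0::'a::real_normed_field) = 0"
  by (simp add: vec_eq_iff axis_def)

lemma norm_axis [simp]: "norm (axis j x :: 'a::real_normed_field ^ 'n::finite) = norm x"
proof (rule antisym)
  have "norm (axis j x :: 'a ^ 'n) \<le> (\<Sum>i\<in>UNIV. norm (axis j x $ i))"
    by (simp add: norm_vec_def L2_set_le_sum)
  also have "(\<Sum>i\<in>UNIV. norm (axis j x $ i)) = (\<Sum>i\<in>UNIV. if i = j then norm x else 0)"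
    by (intro sum.cong) (auto simp: axis_def)
  finally show "norm (axis j x :: 'a ^ 'n) \<le> norm x"
    by simp
  show "norm x \<le> norm (axis j x :: 'a ^ 'n)"
    using Finite_Cartesian_Product.norm_nth_le[of "axis j x" j] by simp
qed

lemma bounded_linear_axis: "bounded_linear (axis j :: 'a::real_normed_field \<Rightarrow> 'a ^ 'n::finite)"
proof (rule bounded_linear_intro[where K = 1])
  show "axis j (x + y) = axis j x + axis j y" for x y :: 'a
    by (rule axis_add)
  show "axis j (r *\<^sub>R x) = r *\<^sub>R axis j x" for r and x :: 'a
    by (simp add: vec_eq_iff axis_def)
qed simp

lemmas continuous_on_axis [continuous_intros] =
  bounded_linear.continuous_on[OF bounded_linear_axis]

lemmas tendsto_axis = bounded_linear.tendsto[OF bounded_linear_axis]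

lemma eventually_axis_in_open:
  fixes S :: "('a::real_normed_field ^ 'n::finite) set"
  assumes "open S" "t \<in> S"
  shows "\<forall>\<^sub>F s in nhds 0. t + axis j s \<in> S"
proof (rule topological_tendstoD[OF _ assms(1)])
  have "((\<lambda>s. t + axis j s) \<longlongrightarrow> t + axis j (0::'a)) (nhds 0)"
    by (intro tendsto_intros tendsto_axis filterlim_ident)
  then show "((\<lambda>s. t + axis j s) \<longlongrightarrow> t) (nhds (0::'a))"
    by simp
qed (use assms in simp)

text \<open>\<open>partial_deriv\<close> is total, so an equation about it does not assert
  differentiability. This relation carries existence and value together.\<close>

definition has_partial ::
  "('a::real_normed_field ^ 'n::finite \<Rightarrow> 'a) \<Rightarrow> 'n \<Rightarrow> 'a ^ 'n \<Rightarrow> 'a \<Rightarrow> bool" where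
  "has_partial f j t D \<longleftrightarrow> ((\<lambda>s. f (t + axis j s)) has_field_derivative D) (at 0)"

lemma has_partial_imp_partial_deriv: "has_partial f j t D \<Longrightarrow> partial_deriv j f t = D"
  by (auto simp: has_partial_def partial_deriv_def intro: DERIV_imp_deriv)

text \<open>Translating the base point along the axis makes one-variable calculus available on a
  whole coordinate line, not just at 0.\<close>

lemma has_partial_at:
  assumes "has_partial f j (t + axis j x) D"
  shows "((\<lambda>s. f (t + axis j s)) has_field_derivative D) (at x)"
proof -
  have "((\<lambda>s. f (t + axis j (s + x))) has_field_derivative D) (at 0)"
    using assms by (simp add: has_partial_def axis_add add_ac)
  then show ?thesis
    using DERIV_shift[of "\<lambda>s. f (t + axis j s)" D 0 x] by simp
qed

lemma has_partial_cong:
  assumes "open S" "t \<in> S" "\<And>t. t \<in> S \<Longrightarrow> f t = h t"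
  shows "has_partial f j t D \<longleftrightarrow> has_partial h j t D"
  unfolding has_partial_def
  using assms eventually_axis_in_open[OF assms(1,2), of j]
  by (intro DERIV_cong_ev refl) (auto elim: eventually_mono)

lemma partial_deriv_cong:
  assumes "open S" "t \<in> S" "\<And>t. t \<in> S \<Longrightarrow> f t = h t"
  shows "partial_deriv j f t = partial_deriv j h t"
  unfolding partial_deriv_def
  using assms eventually_axis_in_open[OF assms(1,2), of j]
  by (intro deriv_cong_ev refl) (auto elim: eventually_mono)

section \<open>Functions with k continuous orders of partial derivatives\<close>

lemma C_k_on_Suc_iff:
  "C_k_on (Suc k) S f \<longleftrightarrow> continuous_on S f \<and>
    (\<forall>j. (\<forall>t\<in>S. has_partial f j t (partial_deriv j f t)) \<and> C_k_on k S (partial_deriv j f))"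
  by (auto simp: has_partial_def partial_deriv_def DERIV_deriv_iff_field_differentiable)

lemma C_k_on_SucD:
  assumes "C_k_on (Suc k) S f"
  shows "continuous_on S f" "\<And>t. t \<in> S \<Longrightarrow> has_partial f j t (partial_deriv j f t)"
    "C_k_on k S (partial_deriv j f)"
  using assms by (auto simp: C_k_on_Suc_iff simp del: C_k_on.simps)

lemma C_k_on_continuous: "C_k_on k S f \<Longrightarrow> continuous_on S f"
  by (cases k) auto

lemma C_k_on_cong:
  assumes "open S" "\<And>t. t \<in> S \<Longrightarrow> f t = h t"
  shows "C_k_on k S f \<longleftrightarrow> C_k_on k S h"
  using assms(2)
proof (induction k arbitrary: f h)
  case 0
  then show ?case
    by (auto cong: continuous_on_cong)
next
  case (Suc k)
  have "continuous_on S f \<longleftrightarrow> continuous_on S h"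
    using Suc.prems by (rule continuous_on_cong[OF refl])
  moreover have "partial_deriv j f t = partial_deriv j h t" if "t \<in> S" for j t
    using partial_deriv_cong[OF assms(1) that] Suc.prems .
  moreover from this have "C_k_on k S (partial_deriv j f) \<longleftrightarrow> C_k_on k S (partial_deriv j h)" for j
    by (intro Suc.IH) auto
  ultimately show ?case
    unfolding C_k_on_Suc_iff
    using has_partial_cong[OF assms(1) _ Suc.prems] by auto
qed

text \<open>The candidates \<open>D j\<close> match the partial derivatives on \<open>S\<close>
  only; \<open>C_k_on_cong\<close> makes this enough. The closure proofs below enter their induction
  step through this rule.\<close>

lemma C_k_on_SucI:
  assumes "open S" "continuous_on S f"
    and "\<And>j t. t \<in> S \<Longrightarrow> has_partial f j t (D j t)" "\<And>j. C_k_on k S (D j)"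
  shows "C_k_on (Suc k) S f"
  unfolding C_k_on_Suc_iff
  using assms has_partial_imp_partial_deriv[OF assms(3)]
    C_k_on_cong[OF assms(1), of "partial_deriv j f" "D j" k for j] by auto

lemma C_k_on_mono: "C_k_on (Suc k) S f \<Longrightarrow> C_k_on k S f"
  by (induction k arbitrary: f) auto

lemma C_k_on_subset: "C_k_on k S f \<Longrightarrow> T \<subseteq> S \<Longrightarrow> C_k_on k T f"
  by (induction k arbitrary: f) (auto intro: continuous_on_subset)

section \<open>Differentiation rules and closure properties\<close>

lemma has_partial_const: "has_partial (\<lambda>t. c) j t 0"
  by (simp add: has_partial_def)

lemma has_partial_add:
  "has_partial f j t D \<Longrightarrow> has_partial h j t E \<Longrightarrow> has_partial (\<lambda>t. f t + h t) j t (D + E)"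
  by (simp add: has_partial_def DERIV_add)

lemma has_partial_mult:
  "has_partial f j t D \<Longrightarrow> has_partial h j t E \<Longrightarrow> has_partial (\<lambda>t. f t * h t) j t (D * h t + f t * E)"
  using DERIV_mult'[of "\<lambda>s. f (t + axis j s)" D 0 UNIV "\<lambda>s. h (t + axis j s)" E]
  by (simp add: has_partial_def add.commute)

lemma has_partial_component: "has_partial (\<lambda>t. t $ i) j t (if i = j then 1 else 0)"
  unfolding has_partial_def axis_def by (auto intro!: derivative_eq_intros)

lemma C_k_on_const: "open S \<Longrightarrow> C_k_on k S (\<lambda>t. c)"
  by (induction k arbitrary: c) (simp_all add: C_k_on_SucI[OF _ _ has_partial_const] del: C_k_on.simps(2))

lemma C_k_on_add:
  assumes "open S" "C_k_on k S f" "C_k_on k S h"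
  shows "C_k_on k S (\<lambda>t. f t + h t)"
  using assms(2,3)
proof (induction k arbitrary: f h)
  case (Suc k)
  note f = C_k_on_SucD[OF Suc.prems(1)] and h = C_k_on_SucD[OF Suc.prems(2)]
  show ?case
  proof (rule C_k_on_SucI[OF assms(1)])
    show "has_partial (\<lambda>t. f t + h t) j t (partial_deriv j f t + partial_deriv j h t)"
      if "t \<in> S" for j t
      using f h that by (intro has_partial_add)
    show "C_k_on k S (\<lambda>t. partial_deriv j f t + partial_deriv j h t)" for j
      using f h by (intro Suc.IH)
  qed (use f h in \<open>intro continuous_intros\<close>)
qed (auto intro: continuous_intros)

lemma C_k_on_mult:
  assumes "open S" "C_k_on k S f" "C_k_on k S h"
  shows "C_k_on k S (\<lambda>t. f t * h t)"
  using assms(2,3)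
proof (induction k arbitrary: f h)
  case (Suc k)
  note f = C_k_on_SucD[OF Suc.prems(1)] and h = C_k_on_SucD[OF Suc.prems(2)]
  show ?case
  proof (rule C_k_on_SucI[OF assms(1)])
    show "has_partial (\<lambda>t. f t * h t) j t (partial_deriv j f t * h t + f t * partial_deriv j h t)"
      if "t \<in> S" for j t
      using f h that by (intro has_partial_mult)
    \<comment> \<open>The product rule leaves one factor undifferentiated in each term;
      \<open>C_k_on_mono\<close> lowers it to order \<open>k\<close> for the induction
      hypothesis.\<close>
    show "C_k_on k S (\<lambda>t. partial_deriv j f t * h t + f t * partial_deriv j h t)" for j
      by (intro C_k_on_add[OF assms(1)] Suc.IH f h Suc.prems[THEN C_k_on_mono])
  qed (use f h in \<open>intro continuous_intros\<close>)
qed (auto intro: continuous_intros)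

lemma C_k_on_component:
  assumes "open S"
  shows "C_k_on k S (\<lambda>t. t $ i)"
proof (cases k)
  case (Suc m)
  show ?thesis
    unfolding Suc
    by (rule C_k_on_SucI[OF assms _ has_partial_component]) (auto intro: continuous_intros C_k_on_const[OF assms])
qed (auto intro: continuous_intros)

lemma has_partial_exp:
  fixes f :: "'a::{real_normed_field, banach} ^ 'n::finite \<Rightarrow> 'a"
  assumes "has_partial f j t D"
  shows "has_partial (\<lambda>t. exp (f t)) j t (exp (f t) * D)"
  using DERIV_chain2[OF DERIV_exp, of "\<lambda>s. f (t + axis j s)" D 0] assms
  by (simp add: has_partial_def)

lemma C_k_on_exp:
  fixes f :: "'a::{real_normed_field, banach} ^ 'n::finite \<Rightarrow> 'a"
  assumes "open S" "C_k_on k S f"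
  shows "C_k_on k S (\<lambda>t. exp (f t))"
  using assms(2)
proof (induction k)
  case (Suc k)
  note f = C_k_on_SucD[OF Suc.prems]
  show ?case
  proof (rule C_k_on_SucI[OF assms(1) _ has_partial_exp[OF f(2)]])
    show "continuous_on S (\<lambda>t. exp (f t))"
      using f(1) by (intro continuous_intros)
    show "C_k_on k S (\<lambda>t. exp (f t) * partial_deriv j f t)" for j
      using C_k_on_mult[OF assms(1) Suc.IH[OF C_k_on_mono[OF Suc.prems]] f(3)] .
  qed
qed (auto intro: continuous_intros)

lemma smooth_imp_C_k: "smooth_fun_on S f \<Longrightarrow> C_k_on k S f"
  by (simp add: smooth_fun_on_def)

lemma smooth_has_partial:
  assumes "smooth_fun_on S f" "t \<in> S"
  shows "has_partial f j t (partial_deriv j f t)"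
  using smooth_imp_C_k[OF assms(1), of "Suc 0"] assms(2) unfolding C_k_on_Suc_iff by auto

lemma smooth_partial_deriv: "smooth_fun_on S f \<Longrightarrow> smooth_fun_on S (partial_deriv j f)"
  unfolding smooth_fun_on_def by (metis C_k_on.simps(2))

lemma smooth_cong:
  "open S \<Longrightarrow> (\<And>t. t \<in> S \<Longrightarrow> f t = h t) \<Longrightarrow> smooth_fun_on S f \<longleftrightarrow> smooth_fun_on S h"
  using C_k_on_cong[of S f h] by (simp add: smooth_fun_on_def)

lemma smooth_subset: "smooth_fun_on S f \<Longrightarrow> T \<subseteq> S \<Longrightarrow> smooth_fun_on T f"
  by (auto simp: smooth_fun_on_def intro: C_k_on_subset)

lemma smooth_closures:
  assumes "open S"
  shows smooth_const: "smooth_fun_on S (\<lambda>t. c)"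
    and smooth_component: "smooth_fun_on S (\<lambda>t. t $ i)"
    and smooth_add: "smooth_fun_on S f \<Longrightarrow> smooth_fun_on S h \<Longrightarrow> smooth_fun_on S (\<lambda>t. f t + h t)"
    and smooth_mult: "smooth_fun_on S f \<Longrightarrow> smooth_fun_on S h \<Longrightarrow> smooth_fun_on S (\<lambda>t. f t * h t)"
  using C_k_on_const[OF assms] C_k_on_component[OF assms] C_k_on_add[OF assms] C_k_on_mult[OF assms]
  unfolding smooth_fun_on_def by blast+

lemma smooth_sum:
  assumes "open S" "\<And>i. i \<in> A \<Longrightarrow> smooth_fun_on S (f i)"
  shows "smooth_fun_on S (\<lambda>t. \<Sum>i\<in>A. f i t)"
  using assms(2)
  by (induction A rule: infinite_finite_induct)
    (auto intro: smooth_const[OF assms(1)] smooth_add[OF assms(1)])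

lemma smooth_exp:
  fixes f :: "'a::{real_normed_field, banach} ^ 'n::finite \<Rightarrow> 'a"
  shows "open S \<Longrightarrow> smooth_fun_on S f \<Longrightarrow> smooth_fun_on S (\<lambda>t. exp (f t))"
  using C_k_on_exp by (auto simp: smooth_fun_on_def)

section \<open>Symmetry of second derivatives and real differentiability\<close>

text \<open>Mean value inequality for \<open>f\<close> minus a linear function of slope
  \<open>c\<close> along one coordinate line. The ball of radius \<open>norm x\<close> in the scalar
  field serves as the convex domain.\<close>

lemma partial_bound:
  fixes f :: "'a::real_normed_field ^ 'n::finite \<Rightarrow> 'a"
  assumes "\<And>s. norm s \<le> norm x \<Longrightarrow> has_partial f j (t + axis j s) (D s)"
    and "\<And>s. norm s \<le> norm x \<Longrightarrow> norm (D s - c) \<le> B"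
  shows "norm (f (t + axis j x) - f t - x * c) \<le> B * norm x"
proof -
  have "norm ((f (t + axis j x) - x * c) - (f (t + axis j 0) - 0 * c)) \<le> B * norm (x - 0)"
  proof (rule field_differentiable_bound[where S = "cball 0 (norm x)" and f' = "\<lambda>s. D s - c"
        and f = "\<lambda>s. f (t + axis j s) - s * c"])
    fix z :: 'a
    assume "z \<in> cball 0 (norm x)"
    then have z: "norm z \<le> norm x"
      by simp
    have "((\<lambda>s. f (t + axis j s) - s * c) has_field_derivative D z - 1 * c) (at z)"
      by (intro DERIV_diff has_partial_at assms(1) DERIV_cmult_right DERIV_ident z)
    then show "((\<lambda>s. f (t + axis j s) - s * c) has_field_derivative D z - c) (at z within cball 0 (norm x))"
      by (simp add: has_field_derivative_at_within)
    show "norm (D z - c) \<le> B"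
      using assms(2)[OF z] .
  qed auto
  then show ?thesis
    by (simp add: algebra_simps)
qed

text \<open>The mean value inequality is used twice: along \<open>i\<close> for the increment of
  \<open>f\<close> in direction \<open>j\<close>, then along \<open>j\<close> for
  \<open>partial_deriv i f\<close>. Continuity of the mixed derivative supplies the bound.\<close>

lemma second_difference_bound:
  fixes f :: "'a::real_normed_field ^ 'n::finite \<Rightarrow> 'a"
  assumes "open S" "t \<in> S" "C_k_on 2 S f" "\<epsilon> > 0"
  shows "\<exists>\<delta>>0. \<forall>h. norm h < \<delta> \<longrightarrow>
    norm (f (t + axis i h + axis j h) - f (t + axis i h) - f (t + axis j h) + f t
      - h * h * partial_deriv j (partial_deriv i f) t) \<le> \<epsilon> * (norm h)\<^sup>2"
proof -
  let ?c = "partial_deriv j (partial_deriv i f)"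
  have C: "C_k_on (Suc (Suc 0)) S f"
    using assms(3) by (simp add: numeral_2_eq_2)
  then have p1: "has_partial f i x (partial_deriv i f x)" if "x \<in> S" for x
    using that unfolding C_k_on_Suc_iff[of "Suc 0"] by auto
  have C1: "C_k_on (Suc 0) S (partial_deriv i f)"
    using C by (auto simp del: C_k_on.simps simp: C_k_on_Suc_iff[of "Suc 0"])
  then have p2: "has_partial (partial_deriv i f) j x (?c x)" if "x \<in> S" for x
    using that unfolding C_k_on_Suc_iff by auto
  have "continuous_on S ?c"
    using C1 by simp
  then obtain r where r: "r > 0" "\<And>x. x \<in> ball t r \<Longrightarrow> x \<in> S \<and> norm (?c x - ?c t) \<le> \<epsilon>"
  proof -
    obtain r1 where r1: "r1 > 0" "ball t r1 \<subseteq> S"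
      using assms by (meson openE)
    obtain r2 where r2: "r2 > 0" "\<And>x. x \<in> S \<Longrightarrow> dist x t < r2 \<Longrightarrow> dist (?c x) (?c t) < \<epsilon>"
      using \<open>continuous_on S ?c\<close> assms by (meson continuous_on_iff)
    show thesis
      using r1 r2 by (intro that[of "min r1 r2"]) (force simp: dist_norm norm_minus_commute)+
  qed
  show ?thesis
  \<comment> \<open>Every point that occurs is reached from \<open>t\<close> by two axis moves of
    length at most \<open>norm h\<close>, hence half the radius.\<close>
  proof (intro exI[of _ "r / 2"] conjI allI impI)
    fix h :: 'a
    assume h: "norm h < r / 2"
    have near: "t + axis i s + axis j s' \<in> ball t r" if "norm s \<le> norm h" "norm s' \<le> norm h" for s s'
    proof -
      have "norm (axis i s + axis j s' :: 'a ^ 'n) \<le> norm s + norm s'"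
        using norm_triangle_ineq[of "axis i s" "axis j s'"] by simp
      moreover have "dist t (t + axis i s + axis j s') = norm (axis i s + axis j s')"
        by (simp only: dist_norm norm_minus_commute[of t] add.assoc add_diff_cancel_left')
      ultimately show ?thesis
        using that h by simp
    qed
    have near0: "t + axis i s \<in> ball t r" if "norm s \<le> norm h" for s
      using near[OF that, of 0] by simp
    define \<phi> where "\<phi> x = f (x + axis j h) - f x" for x
    have part: "has_partial \<phi> i (t + axis i s)
        (partial_deriv i f (t + axis i s + axis j h) - partial_deriv i f (t + axis i s))"
      if s: "norm s \<le> norm h" for s
      using p1[of "t + axis i s + axis j h"] p1[of "t + axis i s"] near[OF s, of h] near0[OF s] r(2)
      unfolding has_partial_def \<phi>_def
      by (auto intro!: DERIV_diff simp: add_ac)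
    have "norm (\<phi> (t + axis i h) - \<phi> t - h * (h * ?c t)) \<le> (\<epsilon> * norm h) * norm h"
    proof (rule partial_bound[OF part])
      fix s :: 'a
      assume s: "norm s \<le> norm h"
      show "norm (partial_deriv i f (t + axis i s + axis j h) - partial_deriv i f (t + axis i s)
        - h * ?c t) \<le> \<epsilon> * norm h"
      proof (rule partial_bound)
        fix s' :: 'a
        assume "norm s' \<le> norm h"
        note r(2)[OF near[OF s this]]
        then show "has_partial (partial_deriv i f) j (t + axis i s + axis j s') (?c (t + axis i s + axis j s'))"
          "norm (?c (t + axis i s + axis j s') - ?c t) \<le> \<epsilon>"
          using p2 by auto
      qed
    qed
    then show "norm (f (t + axis i h + axis j h) - f (t + axis i h) - f (t + axis j h) + f t
        - h * h * ?c t) \<le> \<epsilon> * (norm h)\<^sup>2"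
      by (simp add: \<phi>_def power2_eq_square algebra_simps)
  qed (use r in auto)
qed

text \<open>The second difference is symmetric in \<open>i\<close> and \<open>j\<close>, so both
  mixed derivatives approximate the same quotient by \<open>h * h\<close>.\<close>

lemma partial_deriv_commute:
  fixes f :: "'a::real_normed_field ^ 'n::finite \<Rightarrow> 'a"
  assumes "open S" "t \<in> S" "C_k_on 2 S f"
  shows "partial_deriv i (partial_deriv j f) t = partial_deriv j (partial_deriv i f) t"
proof -
  let ?a = "partial_deriv i (partial_deriv j f) t" and ?b = "partial_deriv j (partial_deriv i f) t"
  have *: "norm (?a - ?b) \<le> 2 * \<epsilon>" if e: "\<epsilon> > 0" for \<epsilon> :: real
  proof -
    obtain r1 where r1: "r1 > 0" "\<And>h. norm h < r1 \<Longrightarrow>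
        norm (f (t + axis i h + axis j h) - f (t + axis i h) - f (t + axis j h) + f t - h * h * ?b)
          \<le> \<epsilon> * (norm h)\<^sup>2"
      using second_difference_bound[OF assms e, of i j] by blast
    obtain r2 where r2: "r2 > 0" "\<And>h. norm h < r2 \<Longrightarrow>
        norm (f (t + axis j h + axis i h) - f (t + axis j h) - f (t + axis i h) + f t - h * h * ?a)
          \<le> \<epsilon> * (norm h)\<^sup>2"
      using second_difference_bound[OF assms e, of j i] by blast
    \<comment> \<open>A real multiple of 1 is a nonzero scalar of prescribed norm in any normed
      field.\<close>
    define h :: 'a where "h = of_real (min r1 r2 / 2)"
    have h: "norm h < r1" "norm h < r2" "norm h > 0"
      using r1(1) r2(1) by (auto simp: h_def simp del: of_real_divide)
    define X where "X = f (t + axis i h + axis j h) - f (t + axis i h) - f (t + axis j h) + f t"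
    have "norm (X - h * h * ?b) \<le> \<epsilon> * (norm h)\<^sup>2" "norm (X - h * h * ?a) \<le> \<epsilon> * (norm h)\<^sup>2"
      using r1(2)[OF h(1)] r2(2)[OF h(2)] by (simp_all add: X_def algebra_simps)
    then have "norm ((X - h * h * ?b) - (X - h * h * ?a)) \<le> 2 * \<epsilon> * (norm h)\<^sup>2"
      using norm_triangle_ineq4[of "X - h * h * ?b" "X - h * h * ?a"] by simp
    also have "(X - h * h * ?b) - (X - h * h * ?a) = h\<^sup>2 * (?a - ?b)"
      by (simp add: power2_eq_square algebra_simps)
    finally have "(norm h)\<^sup>2 * norm (?a - ?b) \<le> (norm h)\<^sup>2 * (2 * \<epsilon>)"
      by (simp add: norm_mult norm_power mult_ac)
    then show ?thesis
      using h(3) by simp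
  qed
  have "norm (?a - ?b) \<le> 0"
  proof (rule field_le_epsilon)
    show "norm (?a - ?b) \<le> 0 + \<epsilon>" if "\<epsilon> > 0" for \<epsilon> :: real
      using *[of "\<epsilon> / 2"] that by simp
  qed
  then show ?thesis
    by simp
qed

text \<open>The derivative over the reals exists because the partial derivatives are continuous.\<close>

lemma has_derivative_real:
  fixes f :: "'a::real_normed_field ^ 'n::finite \<Rightarrow> 'a"
  assumes "open S" "t \<in> S" "C_k_on 1 S f"
  shows "(f has_derivative (\<lambda>h. \<Sum>k\<in>UNIV. h $ k * partial_deriv k f t)) (at t)"
proof -
  have p: "has_partial f k x (partial_deriv k f x)" if "x \<in> S" for x k
    using C_k_on_SucD(2)[of 0 S f x k] assms(3) that by simp
  have cont: "continuous_on S (partial_deriv k f)" for k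
    using assms(3) by simp
  have lin: "bounded_linear (\<lambda>h. \<Sum>k\<in>UNIV. h $ k * partial_deriv k f t)"
    by (intro bounded_linear_sum bounded_linear_mult_const bounded_linear_vec_nth)
  have "\<exists>\<delta>>0. \<forall>y. norm (y - t) < \<delta> \<longrightarrow>
      norm (f y - f t - (\<Sum>k\<in>UNIV. (y - t) $ k * partial_deriv k f t)) \<le> \<epsilon> * norm (y - t)"
    if e: "\<epsilon> > 0" for \<epsilon>
  proof -
    \<comment> \<open>The increment is split into one move per coordinate, each costing at most
      \<open>\<epsilon>' * norm h\<close>.\<close>
    define \<epsilon>' where "\<epsilon>' = \<epsilon> / CARD('n)"
    have e': "\<epsilon>' > 0"
      using e by (simp add: \<epsilon>'_def)
    have "\<forall>\<^sub>F x in nhds t. x \<in> S \<and> norm (partial_deriv k f x - partial_deriv k f t) < \<epsilon>'" for k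
    proof (rule eventually_conj)
      show "\<forall>\<^sub>F x in nhds t. x \<in> S"
        using assms by (simp add: eventually_nhds_in_open)
      have "(partial_deriv k f \<longlongrightarrow> partial_deriv k f t) (nhds t)"
        using cont[of k] assms by (simp add: continuous_on_eq_continuous_at isCont_def tendsto_nhds_iff)
      then show "\<forall>\<^sub>F x in nhds t. norm (partial_deriv k f x - partial_deriv k f t) < \<epsilon>'"
        using e' by (auto dest!: tendstoD simp: dist_norm)
    qed
    then have "\<forall>\<^sub>F x in nhds t. \<forall>k. x \<in> S \<and> norm (partial_deriv k f x - partial_deriv k f t) < \<epsilon>'"
      by (rule eventually_all_finite)
    then obtain \<delta> where \<delta>: "\<delta> > 0" "\<And>x k. dist x t < \<delta> \<Longrightarrow>
        x \<in> S \<and> norm (partial_deriv k f x - partial_deriv k f t) < \<epsilon>'"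
      unfolding eventually_nhds_metric by blast
    have *: "norm (f (t + h) - f t - (\<Sum>k\<in>UNIV. h $ k * partial_deriv k f t)) \<le> \<epsilon> * norm h"
      if h: "norm h < \<delta>" for h
    proof -
      \<comment> \<open>Keeping only the coordinates in \<open>K\<close> gives a path from
        \<open>t\<close> to \<open>t + h\<close>: inserting an index into \<open>K\<close> is a move
        along one axis.\<close>
      define p where "p K = (\<chi> i. if i \<in> K then h $ i else 0)" for K
      have "norm (f (t + p K) - f t - (\<Sum>k\<in>K. h $ k * partial_deriv k f t)) \<le> card K * (\<epsilon>' * norm h)"
        if "finite K" for K
        using that
      proof (induction K)
        case empty
        then show ?case
          by (simp add: p_def zero_vec_def[symmetric])
      next
        case (insert k K)
        have pk: "p (insert k K) = p K + axis k (h $ k)"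
          using insert by (auto simp: p_def axis_def vec_eq_iff)
        have near: "dist (t + p K + axis k s) t < \<delta>" if "norm s \<le> norm (h $ k)" for s
        proof -
          \<comment> \<open>As \<open>k\<close> is not in \<open>K\<close>, each component is
            bounded by that of \<open>h\<close>, so the whole axis segment stays within the
            radius.\<close>
          have "norm (p K + axis k s) \<le> norm h"
            using that insert by (intro norm_le_componentwise_cart) (auto simp: p_def axis_def)
          then show ?thesis
            using h by (simp add: dist_norm add.assoc)
        qed
        have "norm (f (t + p K + axis k (h $ k)) - f (t + p K) - h $ k * partial_deriv k f t)
            \<le> \<epsilon>' * norm (h $ k)"
        proof (rule partial_bound)
          fix s :: 'a
          assume "norm s \<le> norm (h $ k)"
          note \<delta>(2)[OF near[OF this], of k]
          then show "has_partial f k (t + p K + axis k s) (partial_deriv k f (t + p K + axis k s))"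
            "norm (partial_deriv k f (t + p K + axis k s) - partial_deriv k f t) \<le> \<epsilon>'"
            using p by auto
        qed
        also have "\<dots> \<le> \<epsilon>' * norm h"
          using e' Finite_Cartesian_Product.norm_nth_le[of h k] by (intro mult_left_mono) auto
        finally have "norm (f (t + p (insert k K)) - f (t + p K) - h $ k * partial_deriv k f t)
            \<le> \<epsilon>' * norm h"
          by (simp add: pk add.assoc)
        with insert.IH have "norm ((f (t + p (insert k K)) - f (t + p K) - h $ k * partial_deriv k f t)
            + (f (t + p K) - f t - (\<Sum>k\<in>K. h $ k * partial_deriv k f t)))
            \<le> \<epsilon>' * norm h + card K * (\<epsilon>' * norm h)"
          by (intro norm_triangle_mono)
        then show ?case
          using insert.hyps by (simp add: algebra_simps)
      qed
      from this[of UNIV] show ?thesis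
        by (simp add: p_def \<epsilon>'_def)
    qed
    show ?thesis
    proof (intro exI[of _ \<delta>] conjI allI impI)
      fix y
      assume "norm (y - t) < \<delta>"
      from *[OF this] show "norm (f y - f t - (\<Sum>k\<in>UNIV. (y - t) $ k * partial_deriv k f t))
          \<le> \<epsilon> * norm (y - t)"
        by simp
    qed (use \<delta> in simp)
  qed
  with lin show ?thesis
    by (simp add: has_derivative_within_alt)
qed

section \<open>A Poincare lemma for part of the coordinates\<close>

text \<open>Coordinates outside \<open>K\<close> are kept as parameters. \<open>K = UNIV\<close> is
  the radial contraction to 0, a singleton \<open>K\<close> gives integration in one
  variable.\<close>

definition shrink :: "'n set \<Rightarrow> real \<Rightarrow> 'a::real_normed_field ^ 'n::finite \<Rightarrow> 'a ^ 'n" where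
  "shrink K s t = (\<chi> i. if i \<in> K then of_real s * t $ i else t $ i)"

lemma shrink_in_ball:
  assumes "t \<in> ball 0 r" "s \<in> {0..1}"
  shows "shrink K s t \<in> ball 0 r"
proof -
  have "norm (shrink K s t) \<le> norm t"
    using assms by (intro norm_le_componentwise_cart) (auto simp: shrink_def norm_mult mult_left_le_one_le)
  then show ?thesis
    using assms by simp
qed

lemma shrink_one [simp]: "shrink K 1 t = t"
  by (simp add: shrink_def vec_eq_iff)

lemma shrink_affine: "shrink K s t = shrink K 0 t + s *\<^sub>R (\<chi> i. if i \<in> K then t $ i else 0)"
  unfolding vec_eq_iff
  by (simp add: shrink_def scaleR_conv_of_real[of _ "t $ i" for i])

lemma shrink_add_axis:
  "shrink K s (t + axis j x) = shrink K s t + axis j ((if j \<in> K then of_real s else 1) * x)"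
  by (auto simp: shrink_def axis_def vec_eq_iff algebra_simps)

lemma continuous_on_shrink [continuous_intros]:
  assumes "continuous_on A f" "continuous_on A h"
  shows "continuous_on A (\<lambda>x. shrink K (f x) (h x))"
proof -
  have "continuous_on A (\<lambda>x. if i \<in> K then of_real (f x) * h x $ i else h x $ i)" for i
    using assms by (cases "i \<in> K") (auto intro!: continuous_intros)
  then show ?thesis
    unfolding shrink_def by (rule continuous_on_vec_lambda)
qed

text \<open>By the chain rule, each derivative in a direction from \<open>K\<close> brings out one
  more factor \<open>s\<close>. The weight \<open>s ^ m\<close> thus makes the family closed under
  partial derivatives.\<close>

definition shrink_integral :: "'n set \<Rightarrow> nat \<Rightarrow> ('a::{real_normed_field, banach} ^ 'n::finite \<Rightarrow> 'a) \<Rightarrow> 'a ^ 'n \<Rightarrow> 'a" where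
  "shrink_integral K m p t = integral (cbox 0 1) (\<lambda>s. of_real (s ^ m) * p (shrink K s t))"

lemma continuous_on_compose_shrink:
  fixes p :: "'a::real_normed_field ^ 'n::finite \<Rightarrow> 'a"
  assumes "continuous_on (ball 0 r) p" "continuous_on A f" "continuous_on A h"
    and "\<And>x. x \<in> A \<Longrightarrow> f x \<in> {0..1}" "\<And>x. x \<in> A \<Longrightarrow> h x \<in> ball 0 r"
  shows "continuous_on A (\<lambda>x. of_real (f x ^ m) * p (shrink K (f x) (h x)))"
proof -
  have "continuous_on A (\<lambda>x. p (shrink K (f x) (h x)))"
    using assms shrink_in_ball by (intro continuous_on_compose2[OF assms(1)] continuous_intros) blast+
  then show ?thesis
    using assms by (intro continuous_intros)
qed

lemma shrink_integral_integrable: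
  fixes p :: "'a::{real_normed_field, banach} ^ 'n::finite \<Rightarrow> 'a"
  assumes "continuous_on (ball 0 r) p" "t \<in> ball 0 r"
  shows "(\<lambda>s. of_real (s ^ m) * p (shrink K s t)) integrable_on cbox 0 1"
  using assms
  by (intro integrable_continuous continuous_on_compose_shrink[OF assms(1)] continuous_intros) auto

lemma continuous_on_shrink_integral:
  assumes "continuous_on (ball 0 r) p"
  shows "continuous_on (ball 0 r) (shrink_integral K m p)"
proof -
  have "continuous_on (ball 0 r \<times> cbox 0 1) (\<lambda>x. of_real (snd x ^ m) * p (shrink K (snd x) (fst x)))"
    by (intro continuous_on_compose_shrink[OF assms] continuous_intros) auto
  then have "continuous_on (ball 0 r) (\<lambda>t. integral (cbox 0 1) (\<lambda>s. of_real (s ^ m) * p (shrink K s t)))"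
    by (intro integral_continuous_on_param) (simp add: case_prod_unfold)
  then show ?thesis
    by (simp add: shrink_integral_def[abs_def])
qed

lemma has_partial_shrink_integral:
  fixes p :: "'a::{real_normed_field, banach} ^ 'n::finite \<Rightarrow> 'a"
  assumes p: "C_k_on (Suc k) (ball 0 r) p" and t: "t \<in> ball 0 r"
  shows "has_partial (shrink_integral K m p) j t (shrink_integral K (if j \<in> K then Suc m else m) (partial_deriv j p) t)"
proof -
  \<comment> \<open>This radius keeps \<open>t + axis j x\<close> inside the ball; openness of
    \<open>U\<close> later turns the derivative within \<open>U\<close> into an ordinary
    one.\<close>
  define U :: "'a set" where "U = ball 0 (r - norm t)"
  have U: "0 \<in> U" "convex U" "open U"
    using t by (auto simp: U_def)
  have in_ball: "t + axis j x \<in> ball 0 r" if "x \<in> U" for x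
    using that norm_triangle_ineq[of t "axis j x"] by (simp add: U_def)
  let ?n = "if j \<in> K then Suc m else m"
  let ?c = "\<lambda>s::real. if j \<in> K then of_real s else 1 :: 'a"
  let ?f = "\<lambda>x s. of_real (s ^ m) * p (shrink K s (t + axis j x))"
  let ?f' = "\<lambda>x s. of_real (s ^ ?n) * partial_deriv j p (shrink K s (t + axis j x))"
  have "((\<lambda>x. integral (cbox 0 1) (?f x)) has_field_derivative integral (cbox 0 1) (?f' 0)) (at 0 within U)"
  proof (rule leibniz_rule_field_derivative[OF _ _ _ U(1,2)])
    fix x :: 'a and s :: real
    assume x: "x \<in> U" and s: "s \<in> cbox 0 1"
    let ?y = "shrink K s t + axis j (?c s * x)"
    have "has_partial p j ?y (partial_deriv j p ?y)"
      using C_k_on_SucD(2)[OF p shrink_in_ball[OF in_ball[OF x]], of s j K] s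
      by (simp add: shrink_add_axis)
    then have "((\<lambda>z. p (shrink K s t + axis j z)) has_field_derivative partial_deriv j p ?y) (at (?c s * x))"
      by (rule has_partial_at)
    from DERIV_chain2[OF this DERIV_cmult[OF DERIV_ident]]
    have "((\<lambda>x. p (shrink K s t + axis j (?c s * x))) has_field_derivative
        partial_deriv j p ?y * (?c s * 1)) (at x)" .
    from DERIV_cmult[OF this, of "of_real (s ^ m)"]
    show "((\<lambda>x. ?f x s) has_field_derivative ?f' x s) (at x within U)"
      by (auto simp: shrink_add_axis mult_ac intro: has_field_derivative_at_within split: if_splits)
  next
    fix x
    assume "x \<in> U"
    then show "?f x integrable_on cbox 0 1"
      using shrink_integral_integrable[OF C_k_on_continuous[OF p] in_ball] by blast
  next
    have "continuous_on (U \<times> cbox 0 1)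
      (\<lambda>z. of_real (snd z ^ ?n) * partial_deriv j p (shrink K (snd z) (t + axis j (fst z))))"
      using in_ball
      by (intro continuous_on_compose_shrink[OF C_k_on_continuous[OF C_k_on_SucD(3)[OF p]]] continuous_intros)
        auto
    then show "continuous_on (U \<times> cbox 0 1) (\<lambda>(x, s). ?f' x s)"
      by (simp add: case_prod_unfold)
  qed
  then show ?thesis
    unfolding at_within_open[OF U(1,3)] by (simp add: has_partial_def shrink_integral_def)
qed

lemma C_k_on_shrink_integral: "C_k_on k (ball 0 r) p \<Longrightarrow> C_k_on k (ball 0 r) (shrink_integral K m p)"
proof (induction k arbitrary: p m)
  case 0
  then show ?case
    by (simp add: continuous_on_shrink_integral)
next
  case (Suc k)
  show ?case
  proof (rule C_k_on_SucI[OF open_ball])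
    show "continuous_on (ball 0 r) (shrink_integral K m p)"
      using C_k_on_SucD(1)[OF Suc.prems] by (rule continuous_on_shrink_integral)
    show "has_partial (shrink_integral K m p) j t (shrink_integral K (if j \<in> K then Suc m else m) (partial_deriv j p) t)"
      if "t \<in> ball 0 r" for j t
      using Suc.prems that by (rule has_partial_shrink_integral)
    show "C_k_on k (ball 0 r) (shrink_integral K (if j \<in> K then Suc m else m) (partial_deriv j p))" for j
      using C_k_on_SucD(3)[OF Suc.prems] by (rule Suc.IH)
  qed
qed

lemma smooth_shrink_integral: "smooth_fun_on (ball 0 r) p \<Longrightarrow> smooth_fun_on (ball 0 r) (shrink_integral K m p)"
  by (simp add: smooth_fun_on_def C_k_on_shrink_integral)

text \<open>The integrand on the left is the derivative of \<open>s * f (shrink K s t)\<close> in \<open>s\<close>.\<close>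

lemma shrink_integral_fundamental:
  fixes f :: "'a::{real_normed_field, banach} ^ 'n::finite \<Rightarrow> 'a"
  assumes f: "C_k_on (Suc 0) (ball 0 r) f" and t: "t \<in> ball 0 r"
  shows "shrink_integral K 0 f t + (\<Sum>k\<in>K. t $ k * shrink_integral K 1 (partial_deriv k f) t) = f t"
proof -
  define u where "u = (\<chi> i. if i \<in> K then t $ i else 0)"
  let ?D = "\<lambda>s. \<Sum>k\<in>UNIV. u $ k * partial_deriv k f (shrink K s t)"
  have "((\<lambda>s. s *\<^sub>R f (shrink K s t)) has_vector_derivative s *\<^sub>R ?D s + 1 *\<^sub>R f (shrink K s t))
      (at s within {0..1})" if s: "s \<in> {0..1}" for s :: real
  proof -
    have "((\<lambda>s. shrink K 0 t + s *\<^sub>R u) has_derivative (\<lambda>h. h *\<^sub>R u)) (at s)"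
      by (auto intro!: derivative_eq_intros)
    then have "((\<lambda>s. shrink K s t) has_derivative (\<lambda>h. h *\<^sub>R u)) (at s)"
      by (simp only: u_def shrink_affine[symmetric])
    moreover have "(f has_derivative (\<lambda>h. \<Sum>k\<in>UNIV. h $ k * partial_deriv k f (shrink K s t)))
        (at (shrink K s t))"
      using f shrink_in_ball[OF t s] by (intro has_derivative_real[of "ball 0 r"]) auto
    ultimately have "((\<lambda>s. f (shrink K s t)) has_derivative
        (\<lambda>h. \<Sum>k\<in>UNIV. (h *\<^sub>R u) $ k * partial_deriv k f (shrink K s t))) (at s)"
      by (rule has_derivative_compose)
    then have "((\<lambda>s. f (shrink K s t)) has_vector_derivative ?D s) (at s)"
      by (simp add: has_vector_derivative_def scaleR_sum_right)
    then show ?thesis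
      by (rule has_vector_derivative_at_within[OF has_vector_derivative_scaleR[OF DERIV_ident]])
  qed
  \<comment> \<open>The factor \<open>s\<close> kills the lower boundary term, and at
    \<open>s = 1\<close> the point is \<open>t\<close> itself.\<close>
  then have "((\<lambda>s. s *\<^sub>R ?D s + 1 *\<^sub>R f (shrink K s t)) has_integral
      (1 *\<^sub>R f (shrink K 1 t) - 0 *\<^sub>R f (shrink K 0 t))) {0..1}"
    by (intro fundamental_theorem_of_calculus) auto
  then have "f t = integral (cbox 0 1) (\<lambda>s. s *\<^sub>R ?D s + f (shrink K s t))"
    by (simp add: integral_unique cbox_interval)
  also have "(\<lambda>s. s *\<^sub>R ?D s + f (shrink K s t)) = (\<lambda>s. of_real (s ^ 0) * f (shrink K s t)
      + (\<Sum>k\<in>K. t $ k * (of_real (s ^ 1) * partial_deriv k f (shrink K s t))))"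
  proof
    fix s
    have "?D s = (\<Sum>k\<in>K. t $ k * partial_deriv k f (shrink K s t))"
      by (rule sum.mono_neutral_cong_right) (auto simp: u_def)
    then show "s *\<^sub>R ?D s + f (shrink K s t) = of_real (s ^ 0) * f (shrink K s t)
      + (\<Sum>k\<in>K. t $ k * (of_real (s ^ 1) * partial_deriv k f (shrink K s t)))"
      by (simp add: scaleR_conv_of_real sum_distrib_left mult_ac)
  qed
  also have "integral (cbox 0 1) \<dots> = shrink_integral K 0 f t + (\<Sum>k\<in>K. t $ k * shrink_integral K 1 (partial_deriv k f) t)"
  proof -
    have i: "(\<lambda>s. of_real (s ^ 0) * f (shrink K s t)) integrable_on cbox 0 1"
      "(\<lambda>s. of_real (s ^ 1) * partial_deriv k f (shrink K s t)) integrable_on cbox 0 1" for k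
      using f t by (intro shrink_integral_integrable; auto)+
    then have "integral (cbox 0 1) (\<lambda>s. \<Sum>k\<in>K. t $ k * (of_real (s ^ 1) * partial_deriv k f (shrink K s t)))
        = (\<Sum>k\<in>K. t $ k * shrink_integral K 1 (partial_deriv k f) t)"
      unfolding shrink_integral_def by (subst integral_sum) (auto intro!: integrable_on_mult_right)
    moreover have "(\<lambda>s. \<Sum>k\<in>K. t $ k * (of_real (s ^ 1) * partial_deriv k f (shrink K s t)))
        integrable_on cbox 0 1"
      using i by (intro integrable_sum integrable_on_mult_right) auto
    ultimately show ?thesis
      using i(1) by (simp only: Henstock_Kurzweil_Integration.integral_add shrink_integral_def)
  qed
  finally show ?thesis ..
qed

text \<open>The potential is the line integral of the form along the contraction. Closedness
  exchanges \<open>partial_deriv j (a k)\<close> for \<open>partial_deriv k (a j)\<close>, after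
  which \<open>shrink_integral_fundamental\<close> applies to \<open>a j\<close>. The factors
  \<open>t $ k\<close> make it vanish where all coordinates in \<open>K\<close> do.\<close>

lemma partial_poincare:
  fixes a :: "'n::finite \<Rightarrow> 'a::{real_normed_field, banach} ^ 'n \<Rightarrow> 'a"
  assumes smooth: "\<And>k. k \<in> K \<Longrightarrow> smooth_fun_on (ball 0 r) (a k)"
    and closed: "\<And>j k t. j \<in> K \<Longrightarrow> k \<in> K \<Longrightarrow> t \<in> ball 0 r \<Longrightarrow>
      partial_deriv j (a k) t = partial_deriv k (a j) t"
  obtains F where "smooth_fun_on (ball 0 r) F"
    and "\<And>j t. j \<in> K \<Longrightarrow> t \<in> ball 0 r \<Longrightarrow> partial_deriv j F t = a j t"
    and "\<And>t :: 'a ^ 'n. (\<And>k. k \<in> K \<Longrightarrow> t $ k = 0) \<Longrightarrow> F t = 0"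
proof
  define F where "F t = (\<Sum>k\<in>K. t $ k * shrink_integral K 0 (a k) t)" for t
  show "smooth_fun_on (ball 0 r) F"
    unfolding F_def by (intro smooth_sum smooth_mult smooth_component smooth_shrink_integral smooth) auto
  show "F t = 0" if "\<And>k. k \<in> K \<Longrightarrow> t $ k = 0" for t
    using that by (simp add: F_def)
  show "partial_deriv j F t = a j t" if j: "j \<in> K" and t: "t \<in> ball 0 r" for j t
  proof (rule has_partial_imp_partial_deriv)
    have *: "has_partial (\<lambda>t. t $ k * shrink_integral K 0 (a k) t) j t
      ((if k = j then 1 else 0) * shrink_integral K 0 (a k) t + t $ k * shrink_integral K 1 (partial_deriv j (a k)) t)"
      if "k \<in> K" for k
      using has_partial_shrink_integral[OF smooth_imp_C_k[OF smooth[OF that]] t, of K 0 j] j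
      by (intro has_partial_mult has_partial_component) simp
    have "has_partial F j t (\<Sum>k\<in>K. (if k = j then 1 else 0) * shrink_integral K 0 (a k) t
        + t $ k * shrink_integral K 1 (partial_deriv j (a k)) t)"
      using * unfolding F_def has_partial_def by (intro DERIV_sum)
    also have "(\<Sum>k\<in>K. (if k = j then 1 else 0) * shrink_integral K 0 (a k) t
        + t $ k * shrink_integral K 1 (partial_deriv j (a k)) t) =
      shrink_integral K 0 (a j) t + (\<Sum>k\<in>K. t $ k * shrink_integral K 1 (partial_deriv j (a k)) t)"
      using j by (simp add: sum.distrib if_distribR if_distrib[of "\<lambda>x. x * _"] cong: if_cong)
    also have "(\<Sum>k\<in>K. t $ k * shrink_integral K 1 (partial_deriv j (a k)) t) =
        (\<Sum>k\<in>K. t $ k * shrink_integral K 1 (partial_deriv k (a j)) t)"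
      using closed[OF j _ shrink_in_ball[OF t]]
      by (intro sum.cong refl arg_cong[of _ _ "\<lambda>x. _ * x"])
        (auto simp: shrink_integral_def intro!: integral_cong)
    also have "shrink_integral K 0 (a j) t + \<dots> = a j t"
      using smooth_imp_C_k[OF smooth[OF j]] t by (intro shrink_integral_fundamental)
    finally show "has_partial F j t (a j t)" .
  qed
qed

lemma zero_partial_derivs_imp_constant:
  fixes f :: "'a::real_normed_field ^ 'n::finite \<Rightarrow> 'a"
  assumes "C_k_on 1 (ball 0 r) f" "\<And>k t. t \<in> ball 0 r \<Longrightarrow> partial_deriv k f t = 0"
    and t: "t \<in> ball 0 r"
  shows "f t = f 0"
proof -
  have "(f has_derivative (\<lambda>h. 0)) (at x within ball 0 r)" if "x \<in> ball 0 r" for x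
    using has_derivative_real[OF open_ball that assms(1)] assms(2)[OF that]
    by (simp add: has_derivative_at_withinI)
  then show ?thesis
    using t has_derivative_zero_unique[of "ball 0 r" f t 0] by (simp add: le_less_trans[OF norm_ge_zero])
qed

section \<open>The stationary hierarchy in a differential ring\<close>

text \<open>A ring with commuting derivations, in which the hierarchy becomes pure algebra. The
  carrier is a set because the functions smooth on a given domain form only a subset of the function
  type.\<close>

locale diff_ring =
  fixes R :: "'r::comm_ring_1 set" and d :: "nat \<Rightarrow> 'r \<Rightarrow> 'r"
  assumes one_closed [simp]: "1 \<in> R"
    and diff_closed [simp]: "a \<in> R \<Longrightarrow> b \<in> R \<Longrightarrow> a - b \<in> R"
    and mult_closed [simp]: "a \<in> R \<Longrightarrow> b \<in> R \<Longrightarrow> a * b \<in> R"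
    and d_closed [simp]: "a \<in> R \<Longrightarrow> d i a \<in> R"
    and d_add [simp]: "a \<in> R \<Longrightarrow> b \<in> R \<Longrightarrow> d i (a + b) = d i a + d i b"
    and d_mult [simp]: "a \<in> R \<Longrightarrow> b \<in> R \<Longrightarrow> d i (a * b) = d i a * b + a * d i b"
    and d_commute: "a \<in> R \<Longrightarrow> d i (d j a) = d j (d i a)"
begin

lemma zero_closed [simp]: "0 \<in> R"
  using diff_closed[OF one_closed one_closed] by simp

lemma minus_closed [simp]: "a \<in> R \<Longrightarrow> - a \<in> R"
  using diff_closed[of 0 a] by simp

lemma add_closed [simp]: "a \<in> R \<Longrightarrow> b \<in> R \<Longrightarrow> a + b \<in> R"
  using diff_closed[of a "- b"] by simp

lemma numeral_closed [simp]: "numeral k \<in> R"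
  by (induction k) (simp_all only: numeral.simps one_closed add_closed)

lemma sum_closed [simp]: "(\<And>i. i \<in> A \<Longrightarrow> f i \<in> R) \<Longrightarrow> sum f A \<in> R"
  by (induction A rule: infinite_finite_induct) auto

lemma d_zero [simp]: "d i 0 = 0"
  using d_add[of 0 0 i] by simp

lemma d_one [simp]: "d i 1 = 0"
  using d_mult[of 1 1 i] by simp

lemma d_minus [simp]: "a \<in> R \<Longrightarrow> d i (- a) = - d i a"
  using d_add[of a "- a" i] by (simp add: eq_neg_iff_add_eq_0 add.commute)

lemma d_diff [simp]: "a \<in> R \<Longrightarrow> b \<in> R \<Longrightarrow> d i (a - b) = d i a - d i b"
  using d_add[of a "- b" i] by simp

lemma d_numeral [simp]: "d i (numeral k) = 0"
  by (induction k) (simp_all only: numeral.simps d_one d_add numeral_closed one_closed add_closed add_0)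

lemma d_sum: "(\<And>j. j \<in> A \<Longrightarrow> f j \<in> R) \<Longrightarrow> d i (sum f A) = (\<Sum>j\<in>A. d i (f j))"
  by (induction A rule: infinite_finite_induct) auto

section \<open>Coefficientwise derivations on power series\<close>

definition dfps :: "nat \<Rightarrow> 'r fps \<Rightarrow> 'r fps" where
  "dfps i F = Abs_fps (\<lambda>n. d i (fps_nth F n))"

definition Rfps :: "'r fps set" where
  "Rfps = {F. \<forall>n. fps_nth F n \<in> R}"

lemma dfps_nth [simp]: "fps_nth (dfps i F) n = d i (fps_nth F n)"
  by (simp add: dfps_def)

lemma Rfps_nth: "F \<in> Rfps \<Longrightarrow> fps_nth F n \<in> R"
  by (simp add: Rfps_def)

text \<open>The derivation rules proved above thereby become available for generating functions as
  well.\<close>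

lemma diff_ring_fps: "diff_ring Rfps dfps"
proof
  fix a b :: "'r fps" and i j
  assume [simp]: "a \<in> Rfps"
  note [simp] = Rfps_nth[OF this]
  show "dfps i (dfps j a) = dfps j (dfps i a)"
    by (auto simp: fps_eq_iff d_commute[of _ i j])
  show "dfps i a \<in> Rfps"
    by (simp add: Rfps_def)
  assume [simp]: "b \<in> Rfps"
  note [simp] = Rfps_nth[OF this]
  show "a - b \<in> Rfps" "a * b \<in> Rfps"
    by (simp_all add: Rfps_def fps_mult_nth)
  show "dfps i (a + b) = dfps i a + dfps i b"
    by (simp add: fps_eq_iff)
  show "dfps i (a * b) = dfps i a * b + a * dfps i b"
    by (simp add: fps_eq_iff fps_mult_nth d_sum sum.distrib)
qed (simp add: Rfps_def)

end

text \<open>\<open>w\<close> lists the coefficients of W; \<open>recursion\<close> and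
  \<open>flow\<close> are the coefficients of order \<open>i\<close> of the two defining equations.
  \<open>two_cancel\<close> replaces division by 2, since a ring of functions is not a
  field.\<close>

locale stationary_kdv = diff_ring R d
  for R :: "'r::comm_ring_1 set" and d :: "nat \<Rightarrow> 'r \<Rightarrow> 'r" +
  fixes g :: nat and v :: "nat \<Rightarrow> 'r" and w :: "nat \<Rightarrow> 'r"
  assumes g_pos: "1 \<le> g"
    and v_closed [simp]: "v i \<in> R"
    and w_def: "\<And>i. w i = (if i = 0 then 2 else - v i)"
    and v_beyond: "\<And>i. g < i \<Longrightarrow> v i = 0"
    and d_beyond: "\<And>i f. g < i \<Longrightarrow> d i f = 0"
    and two_cancel: "\<And>a b :: 'r. 2 * a = 2 * b \<Longrightarrow> a = b"
    and recursion: "\<And>i. i \<in> {1..g} \<Longrightarrow>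
      4 * d 1 (v (i + 1)) = d 1 (d 1 (d 1 (v i))) - 4 * v 1 * d 1 (v i) - 2 * d 1 (v 1) * v i"
    and flow: "\<And>k i. k \<in> {1..g} \<Longrightarrow> i \<in> {1..g} \<Longrightarrow>
      2 * d k (v i) = (\<Sum>j<k. d 1 (w j) * w (i + k - 1 - j) - w j * d 1 (w (i + k - 1 - j)))"
begin

section \<open>Partial sums of the antisymmetric convolution\<close>

lemma w_closed [simp]: "w i \<in> R"
  by (simp add: w_def)

text \<open>The \<open>j\<close>-th term of the coefficient of order \<open>m\<close> in W' W - W
  W', a series that is zero. The flows are its incomplete sums.\<close>

definition z :: "nat \<Rightarrow> nat \<Rightarrow> 'r" where
  "z m j = d 1 (w j) * w (m - j) - w j * d 1 (w (m - j))"

lemma z_antisym: "j \<le> m \<Longrightarrow> z m (m - j) = - z m j"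
  by (simp add: z_def algebra_simps)

text \<open>The summands are antisymmetric under \<open>j \<mapsto> m - j\<close>, so complementary partial sums agree.\<close>

lemma z_sum_swap:
  assumes "k \<le> Suc m"
  shows "(\<Sum>j<k. z m j) = (\<Sum>j<Suc m - k. z m j)"
proof -
  have total: "(\<Sum>j<Suc m. z m j) = 0"
  proof -
    have "(\<Sum>j<Suc m. z m j) = (\<Sum>j<Suc m. z m (m - j))"
      using sum.nat_diff_reindex[of "z m" "Suc m"] by simp
    also have "\<dots> = - (\<Sum>j<Suc m. z m j)"
      by (simp add: z_antisym flip: sum_negf)
    finally have "2 * (\<Sum>j<Suc m. z m j) = 2 * 0"
      by (simp add: eq_neg_iff_add_eq_0 del: sum.lessThan_Suc)
    then show ?thesis
      by (rule two_cancel)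
  qed
  have "(\<Sum>j<Suc m. z m j) = (\<Sum>j<k. z m j) + (\<Sum>j=k..<Suc m. z m j)"
    using assms by (metis sum.atLeastLessThan_concat le0 atLeast0LessThan)
  also have "(\<Sum>j=k..<Suc m. z m j) = (\<Sum>j<Suc m - k. z m (m - j))"
    by (rule sum.reindex_bij_witness[where i = "\<lambda>j. m - j" and j = "\<lambda>j. m - j"])
      (use assms in auto)
  also have "\<dots> = - (\<Sum>j<Suc m - k. z m j)"
    by (simp add: z_antisym flip: sum_negf)
  finally show ?thesis
    using total by simp
qed

text \<open>This includes \<open>k = g + 1\<close>, where the left side is 0 by convention. On the
  right, passing to the complementary \<open>i\<close> terms leaves only products with a coefficient
  of index \<open>i + g - j > g\<close>, which vanishes.\<close>

lemma flow_z:
  assumes "k \<in> {1..Suc g}" "i \<in> {1..g}"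
  shows "2 * d k (v i) = (\<Sum>j<k. z (i + k - 1) j)"
proof (cases "k \<le> g")
  case True
  then show ?thesis
    using assms flow[of k i] by (simp add: z_def)
next
  case False
  then have [simp]: "k = Suc g"
    using assms by simp
  have "(\<Sum>j<k. z (i + k - 1) j) = (\<Sum>j<i. z (i + k - 1) j)"
    using assms by (subst z_sum_swap) auto
  also have "\<dots> = 0"
    using assms by (intro sum.neutral) (auto simp: z_def w_def v_beyond)
  finally show ?thesis
    by (simp add: d_beyond)
qed

text \<open>Both flows are partial sums for the same \<open>m = i + k - 1\<close>, with
  \<open>k\<close> and \<open>i\<close> terms; these numbers are complementary. At
  \<open>g + 1\<close> both sides are 0.\<close>

lemma flow_symmetric:
  assumes "k \<in> {1..Suc g}" "i \<in> {1..Suc g}"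
  shows "d k (v i) = d i (v k)"
proof -
  consider "k \<le> g" "i \<le> g" | "k = Suc g" | "i = Suc g"
    using assms by fastforce
  then show ?thesis
  proof cases
    case 1
    have "2 * d k (v i) = (\<Sum>j<k. z (i + k - 1) j)"
      using assms 1 by (intro flow_z) auto
    also have "\<dots> = (\<Sum>j<i. z (i + k - 1) j)"
      using assms by (subst z_sum_swap) auto
    also have "\<dots> = 2 * d i (v k)"
      using assms 1 by (subst flow_z) (auto simp: add.commute)
    finally show ?thesis
      by (rule two_cancel)
  qed (simp_all add: d_beyond v_beyond)
qed

text \<open>For \<open>m = i + j\<close> the second sum may be taken over \<open>i\<close> terms
  instead of \<open>j + 1\<close>, so it differs from the first by the single term
  \<open>z (i + j) i\<close>.\<close>

lemma flow_shift:
  assumes "i \<in> {1..g}" "j \<in> {1..g}"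
  shows "2 * d (i + 1) (v j) - 2 * d (j + 1) (v i) = d 1 (v i) * v j - v i * d 1 (v j)"
proof -
  have "2 * d (j + 1) (v i) = (\<Sum>l<j+1. z (i + j) l)"
    using flow_z[of "j + 1" i] assms by simp
  also have "\<dots> = (\<Sum>l<i. z (i + j) l)"
    by (subst z_sum_swap) auto
  finally have 1: "2 * d (j + 1) (v i) = (\<Sum>l<i. z (i + j) l)" .
  have "2 * d (i + 1) (v j) = (\<Sum>l<i+1. z (i + j) l)"
    using flow_z[of "i + 1" j] assms by (simp add: add.commute)
  also have "\<dots> = (\<Sum>l<i. z (i + j) l) + z (i + j) i"
    by simp
  also have "z (i + j) i = d 1 (v i) * v j - v i * d 1 (v j)"
    using assms by (simp add: z_def w_def)
  finally show ?thesis
    using 1 by simp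
qed

section \<open>Commutators of the operators\<close>

definition L :: "'r \<Rightarrow> 'r" where
  "L f = d 1 (d 1 f) - v 1 * f"

text \<open>Four times the operator of the theorem, with the product rule already applied.\<close>

definition U :: "nat \<Rightarrow> 'r \<Rightarrow> 'r" where
  "U i f = 4 * d 1 (d 1 (d i f)) - 4 * v 1 * d i f - 3 * d 1 (v i) * f
     - 2 * v i * d 1 f - 4 * d (i + 1) f"

text \<open>Once derivations are reordered and \<open>d i (v 1)\<close> is replaced by
  \<open>d 1 (v i)\<close>, all derivatives of \<open>f\<close> cancel. The commutator is
  multiplication by the defect of the x-recursion.\<close>

lemma L_U_commute:
  assumes [simp]: "f \<in> R" and i: "i \<in> {1..g}"
  shows "L (U i f) = U i (L f)"
proof -
  have swap: "d i (d (Suc 0) a) = d (Suc 0) (d i a)"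
    "d (Suc i) (d (Suc 0) a) = d (Suc 0) (d (Suc i) a)" if "a \<in> R" for a
    using that by (rule d_commute)+
  have vi: "d i (v (Suc 0)) = d (Suc 0) (v i)" "d (Suc i) (v (Suc 0)) = d (Suc 0) (v (Suc i))"
    using i g_pos by (auto intro: flow_symmetric)
  have "L (U i f) - U i (L f) = f * (d 1 (d 1 (d 1 (v i))) - 4 * v 1 * d 1 (v i)
       - 2 * d 1 (v 1) * v i - 4 * d 1 (v (i + 1)))"
    by (simp add: L_def U_def swap vi algebra_simps)
  then show ?thesis
    unfolding recursion[OF i] by simp
qed

text \<open>The commutator reduces to a first-order operator in \<open>f\<close>. Its coefficients
  are the recursion defects \<open>r i\<close> and \<open>r j\<close>, the defect \<open>q\<close>
  of \<open>flow_shift\<close>, and the x-derivative of \<open>q\<close>.\<close>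

lemma U_U_commute:
  assumes [simp]: "f \<in> R" and i: "i \<in> {1..g}" and j: "j \<in> {1..g}"
  shows "U i (U j f) = U j (U i f)"
proof -
  have swap: "d i (d (Suc 0) a) = d (Suc 0) (d i a)" "d (Suc i) (d (Suc 0) a) = d (Suc 0) (d (Suc i) a)"
    "d j (d (Suc 0) a) = d (Suc 0) (d j a)" "d (Suc j) (d (Suc 0) a) = d (Suc 0) (d (Suc j) a)"
    if "a \<in> R" for a
    using that by (rule d_commute)+
  have swap2: "d j (d i a) = d i (d j a)" "d (Suc j) (d i a) = d i (d (Suc j) a)"
    "d j (d (Suc i) a) = d (Suc i) (d j a)" "d (Suc j) (d (Suc i) a) = d (Suc i) (d (Suc j) a)"
    if "a \<in> R" for a
    using that by (rule d_commute)+
  have vi: "d i (v (Suc 0)) = d (Suc 0) (v i)" "d (Suc i) (v (Suc 0)) = d (Suc 0) (v (Suc i))"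
     "d j (v (Suc 0)) = d (Suc 0) (v j)" "d (Suc j) (v (Suc 0)) = d (Suc 0) (v (Suc j))"
     "d j (v i) = d i (v j)"
    using i j g_pos by (auto intro: flow_symmetric)
  define r where "r k = 4 * d 1 (v (k + 1)) -
    (d 1 (d 1 (d 1 (v k))) - 4 * v 1 * d 1 (v k) - 2 * d 1 (v 1) * v k)" for k
  define q where "q = 2 * d (i + 1) (v j) - 2 * d (j + 1) (v i)
    - (d 1 (v i) * v j - v i * d 1 (v j))"
  have "r i = 0" "r j = 0" "q = 0"
    using recursion[OF i] recursion[OF j] flow_shift[OF i j] by (simp_all add: r_def q_def)
  moreover have "U i (U j f) - U j (U i f) =
      4 * d j f * r i - 4 * d i f * r j + 4 * d 1 f * q + 6 * f * d 1 q"
    by (simp add: U_def r_def q_def swap swap2 vi algebra_simps)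
  ultimately show ?thesis
    by simp
qed

section \<open>The first integral of the hierarchy\<close>

definition W :: "'r fps" where
  "W = Abs_fps w"

text \<open>The right-hand side of the final identity multiplied by the formal variable, which
  clears the pole; the signs come from u' = - W'.\<close>

definition Q :: "'r fps" where
  "Q = fps_X * ((dfps 1 W)\<^sup>2 - 2 * dfps 1 (dfps 1 W) * W)
     + 4 * (1 + fps_X * fps_const (v 1)) * W\<^sup>2"

lemma W_nth [simp]: "fps_nth W n = w n"
  by (simp add: W_def)

text \<open>The recursion for every index: at 0 the constant 2 makes the two remaining terms cancel,
  beyond \<open>g\<close> everything is 0. So it can be read as one equation of power
  series.\<close>

lemma w_recursion:
  "d 1 (d 1 (d 1 (w m))) = 2 * d 1 (v 1) * w m + 4 * d 1 (w (m + 1)) + 4 * v 1 * d 1 (w m)"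
proof -
  consider "m = 0" | "m \<in> {1..g}" | "g < m"
    by fastforce
  then show ?thesis
  proof cases
    case 2
    then show ?thesis
      using recursion[OF 2] by (simp add: w_def algebra_simps)
  qed (simp_all add: w_def v_beyond)
qed

lemma W_recursion:
  "fps_X * dfps 1 (dfps 1 (dfps 1 W)) =
    2 * fps_X * fps_const (d 1 (v 1)) * W + 4 * (1 + fps_X * fps_const (v 1)) * dfps 1 W"
proof (rule fps_ext)
  fix n
  show "fps_nth (fps_X * dfps 1 (dfps 1 (dfps 1 W))) n = fps_nth
    (2 * fps_X * fps_const (d 1 (v 1)) * W + 4 * (1 + fps_X * fps_const (v 1)) * dfps 1 W) n"
    using w_recursion[of "n - 1"]
    by (cases n) (simp_all add: mult.assoc numeral_fps_const w_def[of 0] ring_distribs)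
qed

text \<open>Multiplication by \<open>Y\<close> expresses all derivatives \<open>d k\<close> of W
  through x-derivatives of W and its truncation \<open>P\<close>. For \<open>k = 1\<close>,
  \<open>P\<close> is the constant 2 and this is constancy in x.\<close>

lemma Q_constant:
  assumes k: "k \<in> {1..g}"
  shows "d k (fps_nth Q n) = 0"
proof -
  interpret F: diff_ring Rfps dfps
    by (rule diff_ring_fps)
  let ?a = "fps_const (d 1 (v 1)) :: 'r fps" and ?b = "fps_const (d 1 (v k)) :: 'r fps"
  let ?c = "1 + fps_X * fps_const (v 1) :: 'r fps"
  define P where "P = fps_cutoff k W"
  have [simp]: "W \<in> Rfps" "P \<in> Rfps" "fps_X \<in> Rfps" "fps_const (v m) \<in> Rfps"
    "fps_X ^ m \<in> Rfps" for m
    by (simp_all add: Rfps_def P_def)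
  have [simp]: "dfps i fps_X = 0" "dfps i (fps_X ^ m) = 0"
    "dfps i (fps_const c) = fps_const (d i c)" for i m c
    by (simp_all add: fps_eq_iff)
  define W1 W2 W3 P1 P2 P3 where
    "W1 = dfps 1 W" "W2 = dfps 1 W1" "W3 = dfps 1 W2" "P1 = dfps 1 P" "P2 = dfps 1 P1" "P3 = dfps 1 P2"
  note defs = this
  have [simp]: "W1 \<in> Rfps" "W2 \<in> Rfps" "P1 \<in> Rfps" "P2 \<in> Rfps"
    by (simp_all add: defs)
  have dk_v1: "d k (v 1) = d 1 (v k)"
    using k by (intro flow_symmetric) auto
  have E1: "fps_X * W3 = 2 * fps_X * ?a * W + 4 * ?c * W1"
    using W_recursion by (simp add: defs)
  text \<open>Truncating the recursion at order \<open>k\<close> leaves only the boundary term at order \<open>k\<close>.\<close>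
  have E2: "fps_X * P3 = 2 * fps_X * ?a * P + 4 * ?c * P1 - 4 * ?b * fps_X ^ k"
  proof (rule fps_ext)
    fix n
    show "fps_nth (fps_X * P3) n =
      fps_nth (2 * fps_X * ?a * P + 4 * ?c * P1 - 4 * ?b * fps_X ^ k) n"
      using w_recursion[of "n - 1"] k
      by (cases n) (auto simp: defs P_def mult.assoc numeral_fps_const
          w_def ring_distribs)
  qed
  \<comment> \<open>This clears the factor 1/2 and the most negative power \<open>1 - k\<close> in
    \<open>D_op k\<close>.\<close>
  define Y :: "'r fps" where "Y = 2 * fps_X ^ (k - 1)"
  have [simp]: "Y \<in> Rfps" "dfps i Y = 0" for i
    by (simp_all add: Y_def)
  have XY: "fps_X * Y = 2 * fps_X ^ k"
    using k by (cases k) (auto simp: Y_def)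
  have E3: "Y * dfps k W = P * W1 - P1 * W"
  proof (rule fps_ext)
    fix n
    have "fps_nth (P * W1 - P1 * W) n = (\<Sum>j=0..n. if j < k then - z n j else 0)"
      unfolding fps_mult_nth fps_sub_nth sum_subtractf[symmetric]
      by (intro sum.cong) (auto simp: defs P_def z_def)
    also have "\<dots> = - (\<Sum>j<min k (Suc n). z n j)"
      unfolding sum_negf[symmetric]
      by (intro sum.mono_neutral_cong_right) auto
    also have "\<dots> = fps_nth (Y * dfps k W) n"
    proof (cases "n < k")
      case True
      \<comment> \<open>Below order \<open>k\<close> the truncation is invisible and the full
        antisymmetric sum is 0. On the other side only \<open>n = k - 1\<close> could contribute,
        with \<open>d k (w 0) = 0\<close>.\<close>
      then have "(\<Sum>j<min k (Suc n). z n j) = 0"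
        using z_sum_swap[of "Suc n" n] by (simp add: min_absorb2 del: sum.lessThan_Suc)
      moreover have "n < k - 1 \<or> n = k - 1"
        using True by auto
      ultimately show ?thesis
        by (auto simp: Y_def mult.assoc numeral_fps_const fps_X_power_mult_nth w_def)
    next
      case False
      define i where "i = Suc n - k"
      have n: "n = i + k - 1" "1 \<le> i"
        using False by (auto simp: i_def)
      have "(\<Sum>j<k. z n j) = 2 * d k (v i)"
      proof (cases "i \<le> g")
        case True
        then show ?thesis
          using n k by (subst flow_z) auto
      next
        case False
        \<comment> \<open>Here the second index is \<open>n - j >= i > g\<close>.\<close>
        then have "z n j = 0" if "j < k" for j
          using n that by (simp add: z_def w_def v_beyond)
        then show ?thesis
          using False by (simp add: v_beyond)
      qed
      then show ?thesis
        using n k False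
        by (simp add: Y_def mult.assoc numeral_fps_const fps_X_power_mult_nth w_def)
    qed
    finally show "fps_nth (Y * dfps k W) n = fps_nth (P * W1 - P1 * W) n"
      by simp
  qed
  \<comment> \<open>\<open>Y\<close> is a constant, so applying the x-derivation to
    \<open>E3\<close> yields the flow of W', and once more that of W''.\<close>
  have "Y * dfps k W1 = dfps 1 (Y * dfps k W)"
    by (simp add: defs F.d_commute[of W k])
  then have E4: "Y * dfps k W1 = P * W2 - P2 * W"
    unfolding E3 by (simp add: algebra_simps flip: defs[unfolded One_nat_def])
  have "Y * dfps k W2 = dfps 1 (Y * dfps k W1)"
    by (simp add: defs F.d_commute[of _ k])
  then have E5: "Y * dfps k W2 = P * W3 + P1 * W2 - P2 * W1 - P3 * W"
    unfolding E4 by (simp add: algebra_simps flip: defs[unfolded One_nat_def])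
  \<comment> \<open>After \<open>E3\<close>, \<open>E4\<close> and \<open>E5\<close> third
    derivatives occur only times \<open>fps_X\<close>, ready for \<open>E1\<close> and
    \<open>E2\<close>. The term from \<open>d k (v 1)\<close> cancels the boundary term of
    \<open>E2\<close>.\<close>
  have "Y * dfps k Q = fps_X * (2 * W1 * (Y * dfps k W1) - 2 * W * (Y * dfps k W2) - 2 * W2 * (Y * dfps k W))
      + 4 * (fps_X * Y) * ?b * W\<^sup>2 + 8 * ?c * W * (Y * dfps k W)"
    by (simp add: Q_def power2_eq_square dk_v1[unfolded One_nat_def] algebra_simps flip: defs[unfolded One_nat_def])
  also have "\<dots> = - 2 * W * P * (fps_X * W3) + 2 * W\<^sup>2 * (fps_X * P3) + 8 * fps_X ^ k * ?b * W\<^sup>2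
      + 8 * ?c * W * (P * W1 - P1 * W)"
    unfolding E3 E4 E5 XY by (simp add: power2_eq_square algebra_simps)
  also have "\<dots> = 0"
    unfolding E1 E2 by (simp add: power2_eq_square algebra_simps)
  \<comment> \<open>Reading the coefficient at the shifted index removes the power of the variable
    without division.\<close>
  finally have "fps_nth (2 * (fps_X ^ (k - 1) * dfps k Q)) (n + (k - 1)) = 0"
    by (simp add: Y_def mult.assoc)
  then have "2 * d k (fps_nth Q n) = 2 * 0"
    by (simp add: numeral_fps_const fps_X_power_mult_nth)
  then show ?thesis
    by (rule two_cancel)
qed

text \<open>This coefficient gives the pole term of the final identity, as 16 = 4 * 4.\<close>

lemma Q_0: "fps_nth Q 0 = 16"
  by (simp add: Q_def numeral_fps_const power2_eq_square w_def)

text \<open>The square of W contributes \<open>- 16 * v 1\<close> and the term with the factor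
  \<open>v 1\<close> contributes \<open>16 * v 1\<close>, so the final identity has no constant
  term.\<close>

lemma Q_1: "fps_nth Q 1 = 0"
  by (simp add: Q_def numeral_fps_const power2_eq_square w_def fps_mult_nth_1 mult.assoc distrib_right)

text \<open>W has degree at most \<open>g\<close>, so its quadratic expressions have degree at most
  \<open>2 * g\<close>; one factor \<open>fps_X\<close> adds 1.\<close>

lemma Q_beyond:
  assumes "2 * g + 1 < n"
  shows "fps_nth Q n = 0"
proof -
  have *: "fps_nth (A * B) m = 0"
    if "\<And>j. g < j \<Longrightarrow> fps_nth A j = 0" "\<And>j. g < j \<Longrightarrow> fps_nth B j = 0" "2 * g < m"
    for A B :: "'r fps" and m
    unfolding fps_mult_nth
  proof (rule sum.neutral, rule ballI)
    fix j
    assume "j \<in> {0..m}"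
    then show "fps_nth A j * fps_nth B (m - j) = 0"
      using that by (cases "g < j") auto
  qed
  have [simp]: "w j = 0" if "g < j" for j
    using that by (simp add: w_def v_beyond)
  show ?thesis
    using assms by (cases n)
      (simp_all add: Q_def numeral_fps_const power2_eq_square mult.assoc distrib_right *)
qed

text \<open>The operators of the theorem are 1/4 times \<open>U\<close>; this rule and the next move
  that constant past an operator.\<close>

lemma L_const_mult:
  assumes "f \<in> R" "q \<in> R" "\<And>k. d k q = 0"
  shows "L (q * f) = q * L f"
  using assms by (simp add: L_def algebra_simps)

lemma U_const_mult:
  assumes "f \<in> R" "q \<in> R" "\<And>k. d k q = 0"
  shows "U i (q * f) = q * U i f"
  using assms by (simp add: U_def algebra_simps)

lemma L_closed [simp]: "f \<in> R \<Longrightarrow> L f \<in> R"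
  by (simp add: L_def)

lemma U_closed [simp]: "f \<in> R \<Longrightarrow> U i f \<in> R"
  by (simp add: U_def)

end

section \<open>From smooth functions to the differential ring\<close>

lemma sum_fun_apply: "(\<Sum>i\<in>A. f i) t = (\<Sum>i\<in>A. f i t)"
  by (induction A rule: infinite_finite_induct) auto

lemma numeral_fun_apply [simp]: "numeral k t = numeral k"
  by (induction k) (simp_all only: numeral.simps plus_fun_apply one_fun_apply)

text \<open>Setting the derivative to 0 off \<open>N\<close> makes the rules of
  \<open>diff_ring\<close> equations between functions, not only equations on
  \<open>N\<close>.\<close>

definition rpd :: "(nat \<Rightarrow> 'n::finite) \<Rightarrow> ('a::real_normed_field ^ 'n) set \<Rightarrow> nat
    \<Rightarrow> ('a ^ 'n \<Rightarrow> 'a) \<Rightarrow> 'a ^ 'n \<Rightarrow> 'a" where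
  "rpd e N i f = (\<lambda>t. if t \<in> N then pd e i f t else 0)"

lemma pd_cong:
  assumes "open N" "t \<in> N" "\<And>t. t \<in> N \<Longrightarrow> f t = h t"
  shows "pd e i f t = pd e i h t"
  using partial_deriv_cong[OF assms] by (simp add: pd_def)

text \<open>Agreement on \<open>N\<close> is both hypothesis and, pointwise, conclusion, so the rule
  can be iterated through nested derivatives.\<close>

lemma pd_eq_rpd:
  assumes "open N" "t \<in> N" "\<And>t. t \<in> N \<Longrightarrow> f t = h t"
  shows "pd e i f t = rpd e N i h t"
  using pd_cong[OF assms, where e = e and i = i] assms(2) by (simp add: rpd_def)

lemma smooth_pd: "open N \<Longrightarrow> smooth_fun_on N f \<Longrightarrow> smooth_fun_on N (pd e i f)"
  by (simp add: pd_def smooth_partial_deriv smooth_const)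

lemma diff_ring_functions:
  fixes N :: "('a::real_normed_field ^ 'n::finite) set"
  assumes N: "open N"
  shows "diff_ring {f. smooth_fun_on N f} (rpd e N)"
proof
  fix f h :: "'a ^ 'n \<Rightarrow> 'a" and i j
  show "1 \<in> {f :: 'a ^ 'n \<Rightarrow> 'a. smooth_fun_on N f}"
    using smooth_const[OF N, of 1] by (simp add: one_fun_def)
  assume "f \<in> {f. smooth_fun_on N f}"
  then have f: "smooth_fun_on N f"
    by simp
  have rpd_f: "smooth_fun_on N (rpd e N i f)" for i
    using smooth_cong[OF N, of "rpd e N i f" "pd e i f"] smooth_pd[OF N f] by (simp add: rpd_def)
  then show "rpd e N i f \<in> {f. smooth_fun_on N f}"
    by simp
  have "pd e i (rpd e N j f) t = pd e j (rpd e N i f) t" if t: "t \<in> N" for t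
  proof -
    \<comment> \<open>If an index is out of range, each side is 0 or the derivative of the zero
      function.\<close>
    have "pd e i (pd e j f) t = pd e j (pd e i f) t"
      using partial_deriv_commute[OF N t smooth_imp_C_k[OF f]]
      by (simp add: pd_def partial_deriv_def)
    then show ?thesis
      using pd_cong[OF N t, of "rpd e N j f" "pd e j f" e i]
        pd_cong[OF N t, of "rpd e N i f" "pd e i f" e j] by (simp add: rpd_def)
  qed
  then show "rpd e N i (rpd e N j f) = rpd e N j (rpd e N i f)"
    by (auto simp: fun_eq_iff rpd_def[of e N i "rpd e N j f"] rpd_def[of e N j "rpd e N i f"])
  assume "h \<in> {f. smooth_fun_on N f}"
  then have h: "smooth_fun_on N h"
    by simp
  show "f - h \<in> {f. smooth_fun_on N f}"
    using smooth_add[OF N f smooth_mult[OF N smooth_const[OF N, of "-1"] h]]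
    by (simp add: fun_diff_def)
  show "f * h \<in> {f. smooth_fun_on N f}"
    using smooth_mult[OF N f h] by (simp add: times_fun_def)
  show "rpd e N i (f + h) = rpd e N i f + rpd e N i h"
    using has_partial_imp_partial_deriv[OF has_partial_add[OF smooth_has_partial[OF f] smooth_has_partial[OF h]]]
    by (auto simp: fun_eq_iff rpd_def pd_def plus_fun_def)
  show "rpd e N i (f * h) = rpd e N i f * h + f * rpd e N i h"
    using has_partial_imp_partial_deriv[OF has_partial_mult[OF smooth_has_partial[OF f] smooth_has_partial[OF h]]]
    by (auto simp: fun_eq_iff rpd_def pd_def times_fun_def)
qed

section \<open>Evaluating series of functions at a point and comparing coefficients\<close>

definition fps_at :: "'b \<Rightarrow> ('b \<Rightarrow> 'a::comm_ring_1) fps \<Rightarrow> 'a fps" where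
  "fps_at t F = Abs_fps (\<lambda>n. fps_nth F n t)"

lemma fps_at_nth [simp]: "fps_nth (fps_at t F) n = fps_nth F n t"
  by (simp add: fps_at_def)

text \<open>Evaluation at a point is a ring homomorphism, which carries \<open>Q\<close> over to
  scalar series.\<close>

lemma fps_at_simps [simp]:
  "fps_at t (F + H) = fps_at t F + fps_at t H" "fps_at t (F - H) = fps_at t F - fps_at t H"
  "fps_at t (F * H) = fps_at t F * fps_at t H" "fps_at t (numeral k) = numeral k"
  "fps_at t 1 = 1" "fps_at t fps_X = fps_X" "fps_at t (fps_const f) = fps_const (f t)"
  by (auto simp: fps_eq_iff fps_mult_nth sum_fun_apply fps_numeral_nth)

lemma gen_fun_nth:
  fixes c :: "nat \<Rightarrow> 'a::real_normed_field ^ 'n::finite \<Rightarrow> 'a"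
  shows "fls_nth (gen_fun c t) n = (if 1 \<le> n \<and> n \<le> int CARD('n) then c (nat n) t else 0)"
proof -
  have "fls_nth (gen_fun c t) n = (\<Sum>i=1..CARD('n). if i = nat n \<and> 0 \<le> n then c i t else 0)"
    unfolding gen_fun_def fls_nth_sum by (intro sum.cong) auto
  also have "\<dots> = (if 1 \<le> n \<and> n \<le> int CARD('n) then c (nat n) t else 0)"
    by (cases "0 \<le> n") auto
  finally show ?thesis .
qed

text \<open>Each power of the variable in \<open>D_op\<close> shifts the coefficients of
  \<open>h\<close>; this exposes the flow as an incomplete convolution.\<close>

lemma D_op_times_nth:
  fixes f h :: "'a::field fls"
  shows "fls_nth (D_op k f * h) n = 1 / 2 * (\<Sum>j<k. fls_nth f (int j) * fls_nth h (n + int k - 1 - int j))"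
proof -
  have "fls_nth (D_op k f * h) n =
      1 / 2 * (\<Sum>j<k. fls_nth (fls_const (fls_nth f (int j)) * (fls_X_intpow (int j - int k + 1) * h)) n)"
    by (simp only: D_op_def mult.assoc sum_distrib_right fls_mult_const_nth fls_nth_sum)
  also have "(\<Sum>j<k. fls_nth (fls_const (fls_nth f (int j)) * (fls_X_intpow (int j - int k + 1) * h)) n)
      = (\<Sum>j<k. fls_nth f (int j) * fls_nth h (n + int k - 1 - int j))"
    unfolding fls_X_intpow_times_conv_shift fls_mult_const_nth
    by (intro sum.cong refl) (simp add: algebra_simps)
  finally show ?thesis .
qed

lemma stationary_gKdV_imp_stationary_kdv:
  fixes e :: "nat \<Rightarrow> 'n::finite" and S N :: "('a::real_normed_field ^ 'n) set"
  assumes "stationary_gKdV e S u" "open N" "N \<subseteq> S"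
  obtains v where "\<And>t. t \<in> N \<Longrightarrow> u t = v 1 t"
    and "stationary_kdv {f. smooth_fun_on N f} (rpd e N) CARD('n) v (\<lambda>i. if i = 0 then 2 else - v i)"
proof -
  let ?g = "CARD('n)"
  obtain v0 where smooth: "\<And>i. i \<in> {1..?g} \<Longrightarrow> smooth_fun_on S (v0 i)"
    and u: "\<And>t. t \<in> S \<Longrightarrow> u t = v0 1 t"
    and eq1: "\<And>t. t \<in> S \<Longrightarrow> gen_fun (\<lambda>i. pd e 1 (pd e 1 (pd e 1 (v0 i)))) t
        + 2 * fls_const (pd e 1 (v0 1) t) * (2 - gen_fun v0 t)
        - 4 * (fls_X_inv + fls_const (v0 1 t)) * gen_fun (\<lambda>i. pd e 1 (v0 i)) t = 0"
    and eq2: "\<And>k t. k \<in> {1..?g} \<Longrightarrow> t \<in> S \<Longrightarrow> gen_fun (\<lambda>i. pd e k (v0 i)) t =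
          D_op k (2 - gen_fun v0 t) * gen_fun (\<lambda>i. pd e 1 (v0 i)) t
          - D_op k (gen_fun (\<lambda>i. pd e 1 (v0 i)) t) * (2 - gen_fun v0 t)"
    using assms(1) unfolding stationary_gKdV_def by metis
  \<comment> \<open>The given sequence is arbitrary outside \<open>1..g\<close>; the truncated one
    satisfies \<open>v_beyond\<close> and is smooth at every index.\<close>
  define v where "v i = (if i \<in> {1..?g} then v0 i else 0)" for i
  define w where "w i = (if i = 0 then 2 else - v i)" for i
  have g: "1 \<le> ?g"
    by (simp add: Suc_le_eq)
  interpret diff_ring "{f. smooth_fun_on N f}" "rpd e N"
    using assms(2) by (rule diff_ring_functions)
  have v: "v i \<in> {f. smooth_fun_on N f}" for i
    using smooth_subset[OF smooth assms(3)] zero_closed by (auto simp: v_def)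
  have pd3: "pd e 1 (pd e 1 (pd e 1 f)) t = rpd e N 1 (rpd e N 1 (rpd e N 1 f)) t"
    if "t \<in> N" for f t
    using that assms(2) by (intro pd_eq_rpd) auto
  have pd1: "pd e k f t = rpd e N k f t" if "t \<in> N" for f t k
    using that assms(2) by (intro pd_eq_rpd) auto
  have outside: "rpd e N k f t = 0" if "t \<notin> N" for k f t
    using that by (simp add: rpd_def)
  have W: "fls_nth (2 - gen_fun v0 t) (int n) = w n t" for n t
    by (auto simp: gen_fun_nth w_def v_def)
  have W': "fls_nth (gen_fun (\<lambda>i. pd e 1 (v0 i)) t) (int n) = - rpd e N 1 (w n) t"
    if "t \<in> N" for n t
  proof -
    have "rpd e N 1 (- v n) = - rpd e N 1 (v n)"
      by (rule d_minus[OF v])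
    moreover have "v n = (if n \<in> {1..?g} then v0 n else 0)"
      by (simp add: v_def)
    ultimately show ?thesis
      by (auto simp: gen_fun_nth w_def pd1[OF that])
  qed
  have "stationary_kdv {f. smooth_fun_on N f} (rpd e N) ?g v w"
  proof
    show "v i \<in> {f. smooth_fun_on N f}" for i
      by (rule v)
    show "a = b" if "2 * a = 2 * b" for a b :: "'a ^ 'n \<Rightarrow> 'a"
    proof
      fix t
      show "a t = b t"
        using fun_cong[OF that, of t] by simp
    qed
    show "rpd e N i f = 0" if "?g < i" for i f
      using that by (auto simp: rpd_def pd_def)
    fix i
    assume i: "i \<in> {1..?g}"
    show "4 * rpd e N 1 (v (i + 1)) = rpd e N 1 (rpd e N 1 (rpd e N 1 (v i)))
        - 4 * v 1 * rpd e N 1 (v i) - 2 * rpd e N 1 (v 1) * v i"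
    proof
      fix t
      show "(4 * rpd e N 1 (v (i + 1))) t = (rpd e N 1 (rpd e N 1 (rpd e N 1 (v i)))
        - 4 * v 1 * rpd e N 1 (v i) - 2 * rpd e N 1 (v 1) * v i) t"
      proof (cases "t \<in> N")
        case True
        then have "fls_nth (gen_fun (\<lambda>i. pd e 1 (pd e 1 (pd e 1 (v0 i)))) t
          + 2 * (fls_const (pd e 1 (v0 1) t) * (2 - gen_fun v0 t))
          - 4 * (fls_X_inv * gen_fun (\<lambda>i. pd e 1 (v0 i)) t
            + fls_const (v0 1 t) * gen_fun (\<lambda>i. pd e 1 (v0 i)) t)) (int i) = 0"
          using arg_cong[OF eq1, of t "\<lambda>x. fls_nth x (int i)"] assms(3)
          by (auto simp: mult.assoc distrib_right)
        moreover have "fls_nth (gen_fun (\<lambda>i. pd e 1 (pd e 1 (pd e 1 (v0 i)))) t) (int i) =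
            rpd e N 1 (rpd e N 1 (rpd e N 1 (v i))) t"
          using i by (simp add: gen_fun_nth v_def pd3[OF True, unfolded One_nat_def])
        moreover have "pd e 1 (v0 1) t = rpd e N 1 (v 1) t" "v0 1 t = v 1 t"
          using g by (simp_all add: v_def pd1[OF True])
        moreover have "int i + 1 = int (i + 1)"
          by simp
        ultimately have "rpd e N 1 (rpd e N 1 (rpd e N 1 (v i))) t + 2 * (rpd e N 1 (v 1) t * w i t)
            - 4 * (- rpd e N 1 (w (i + 1)) t + v 1 t * (- rpd e N 1 (w i) t)) = 0"
          by (simp only: fls_X_inv_times_conv_shift fls_plus_nth fls_minus_nth[of "_ + _"]
              fls_mult_of_numeral_nth fls_mult_const_nth fls_shift_nth W W'[OF True])
        moreover have "rpd e N 1 (w (i + 1)) = - rpd e N 1 (v (i + 1))" "rpd e N 1 (w i) = - rpd e N 1 (v i)"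
          "w i = - v i"
          using i d_minus[OF v] by (simp_all add: w_def)
        ultimately show ?thesis
          by (simp add: algebra_simps)
      qed (simp add: outside)
    qed
    fix k
    assume k: "k \<in> {1..?g}"
    show "2 * rpd e N k (v i) = (\<Sum>j<k. rpd e N 1 (w j) * w (i + k - 1 - j)
        - w j * rpd e N 1 (w (i + k - 1 - j)))"
    proof
      fix t
      show "(2 * rpd e N k (v i)) t = (\<Sum>j<k. rpd e N 1 (w j) * w (i + k - 1 - j)
        - w j * rpd e N 1 (w (i + k - 1 - j))) t"
      proof (cases "t \<in> N")
        case True
        \<comment> \<open>Since \<open>i >= 1\<close> and \<open>j < k\<close>, the natural
          subtraction is exact and agrees with the integer index.\<close>
        have idx: "(\<Sum>j<k. F j * fls_nth H (int i + int k - 1 - int j)) =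
            (\<Sum>j<k. F j * fls_nth H (int (i + k - 1 - j)))" for F and H :: "'a fls"
          using i by (intro sum.cong refl arg_cong2[of _ _ _ _ "(*)"] arg_cong[of _ _ "fls_nth H"]) auto
        have "fls_nth (gen_fun (\<lambda>i. pd e k (v0 i)) t) (int i) =
          1 / 2 * (\<Sum>j<k. w j t * (- rpd e N 1 (w (i + k - 1 - j)) t))
          - 1 / 2 * (\<Sum>j<k. (- rpd e N 1 (w j) t) * w (i + k - 1 - j) t)"
          unfolding eq2[OF k subsetD[OF assms(3) True]]
          by (simp only: fls_minus_nth[of "_ * _"] D_op_times_nth W W'[OF True] idx)
        moreover have "fls_nth (gen_fun (\<lambda>i. pd e k (v0 i)) t) (int i) = rpd e N k (v i) t"
          using i by (simp add: gen_fun_nth v_def pd1[OF True])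
        ultimately show ?thesis
          by (simp add: sum_fun_apply sum_subtractf sum_negf algebra_simps)
      qed (simp add: outside sum_fun_apply)
    qed
  qed (use g in \<open>auto simp: w_def v_def\<close>)
  moreover have "u t = v 1 t" if "t \<in> N" for t
    using u that assms(3) g by (auto simp: v_def)
  ultimately show thesis
    by (intro that[of v]) (simp_all add: w_def[abs_def])
qed

section \<open>Potential, commutativity and first integral\<close>

text \<open>Integrating \<open>P\<close> from the hyperplane where the first coordinate is 0 also
  normalises \<open>l\<close>: its x-derivative at 0 is \<open>P 0 = 0\<close>, and its other
  derivatives at 0 run inside that hyperplane, where \<open>l\<close> vanishes.\<close>

lemma exists_log_tau:
  fixes e :: "nat \<Rightarrow> 'n::finite" and v :: "nat \<Rightarrow> 'a::{real_normed_field, banach} ^ 'n \<Rightarrow> 'a"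
  assumes e: "bij_betw e {1..CARD('n)} UNIV" and r: "r > 0"
    and v: "\<And>k. smooth_fun_on (ball 0 r) (v k)"
    and closed: "\<And>i k t. i \<in> {1..CARD('n)} \<Longrightarrow> k \<in> {1..CARD('n)} \<Longrightarrow> t \<in> ball 0 r \<Longrightarrow>
      pd e i (v k) t = pd e k (v i) t"
  obtains l where "smooth_fun_on (ball 0 r) l" "l 0 = 0"
    "\<And>k. k \<in> {1..CARD('n)} \<Longrightarrow> pd e k l 0 = 0"
    "\<And>k t. k \<in> {1..CARD('n)} \<Longrightarrow> t \<in> ball 0 r \<Longrightarrow> - 2 * pd e 1 (pd e k l) t = v k t"
proof -
  define idx where "idx = inv_into {1..CARD('n)} e"
  have idx: "idx j \<in> {1..CARD('n)}" "e (idx j) = j" for j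
    using bij_betw_inv_into[OF e] bij_betw_inv_into_right[OF e] by (auto simp: idx_def bij_betw_def)
  have idx_e: "idx (e k) = k" if "k \<in> {1..CARD('n)}" for k
    using bij_betw_inv_into_left[OF e that] by (simp add: idx_def)
  have one: "1 \<in> {1..CARD('n)}"
    by (simp add: Suc_le_eq)
  let ?a = "\<lambda>j t. - 1 / 2 * v (idx j) t"
  have pd_a: "partial_deriv j (?a k) t = - 1 / 2 * pd e (idx j) (v (idx k)) t"
    if "t \<in> ball 0 r" for j k t
    using has_partial_imp_partial_deriv[OF
        has_partial_mult[OF has_partial_const smooth_has_partial[OF v that]], of j "- 1 / 2" "idx k"]
      idx[of j]
    by (simp add: pd_def)
  obtain P where P: "smooth_fun_on (ball 0 r) P"
    "\<And>j t. t \<in> ball 0 r \<Longrightarrow> partial_deriv j P t = ?a j t"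
    "P 0 = 0"
  proof (rule partial_poincare[of UNIV r ?a])
    show "smooth_fun_on (ball 0 r) (?a k)" for k
      by (intro smooth_mult smooth_const v open_ball)
    show "partial_deriv j (?a k) t = partial_deriv k (?a j) t" if "t \<in> ball 0 r" for j k t
      using that idx closed by (simp only: pd_a)
  qed auto
  obtain l where l: "smooth_fun_on (ball 0 r) l"
    "\<And>t. t \<in> ball 0 r \<Longrightarrow> partial_deriv (e 1) l t = P t"
    "\<And>t :: 'a ^ 'n. t $ e 1 = 0 \<Longrightarrow> l t = 0"
    by (rule partial_poincare[of "{e 1}" r "\<lambda>_. P"]) (use P in auto)
  show thesis
  proof
    show "smooth_fun_on (ball 0 r) l" "l 0 = 0"
      using l by simp_all
    fix k
    assume k: "k \<in> {1..CARD('n)}"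
    show "pd e k l 0 = 0"
    proof (cases "k = 1")
      case True
      then show ?thesis
        using l(2)[of 0] P(3) r one by (simp add: pd_def)
    next
      case False
      then have "e k \<noteq> e 1"
        using idx_e[OF k] idx_e[OF one] by metis
      then have "l (0 + axis (e k) s) = 0" for s
        by (intro l(3)) (simp add: axis_def)
      then show ?thesis
        by (simp add: pd_def partial_deriv_def)
    qed
    fix t :: "'a ^ 'n"
    assume t: "t \<in> ball 0 r"
    have "pd e 1 (pd e k l) t = partial_deriv (e 1) (partial_deriv (e k) l) t"
      using one k by (simp add: pd_def)
    also have "\<dots> = partial_deriv (e k) (partial_deriv (e 1) l) t"
      by (rule partial_deriv_commute[OF open_ball t smooth_imp_C_k[OF l(1)]])
    also have "\<dots> = partial_deriv (e k) P t"
      by (rule partial_deriv_cong[OF open_ball t l(2)])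
    also have "\<dots> = - 1 / 2 * v k t"
      using P(2)[OF t] idx_e[OF k] by simp
    finally show "- 2 * pd e 1 (pd e k l) t = v k t"
      by simp
  qed
qed

text \<open>On \<open>N\<close> the concrete operators agree with \<open>K.L\<close> and
  \<open>q * K.U k\<close>, even for arguments that match only on \<open>N\<close>. This is what
  compositions require.\<close>

lemma operators_commute:
  fixes e :: "nat \<Rightarrow> 'n::finite" and N :: "('a::real_normed_field ^ 'n) set"
  assumes kdv: "stationary_kdv {f. smooth_fun_on N f} (rpd e N) CARD('n) v w" and N: "open N"
    and u: "\<And>k t. k \<in> {1..CARD('n)} \<Longrightarrow> t \<in> N \<Longrightarrow> u k t = v k t"
    and i: "i \<in> {1..CARD('n)}"
  shows "ops_commute_on N (L_op e u) (U_op e u i)"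
    and "j \<in> {1..CARD('n)} \<Longrightarrow> ops_commute_on N (U_op e u i) (U_op e u j)"
proof -
  interpret K: stationary_kdv "{f. smooth_fun_on N f}" "rpd e N" "CARD('n)" v w
    by (rule kdv)
  define q :: "'a ^ 'n \<Rightarrow> 'a" where "q = (\<lambda>t. 1 / 4)"
  have q: "q \<in> {f. smooth_fun_on N f}" "rpd e N k q = 0" for k
    using smooth_const[OF N] has_partial_imp_partial_deriv[OF has_partial_const]
    by (auto simp: q_def rpd_def pd_def fun_eq_iff)
  have v: "smooth_fun_on N (v k)" for k
    using K.v_closed by simp
  note agree = pd_eq_rpd[OF N]
  have L: "L_op e u f t = K.L h t" if "t \<in> N" "\<And>t. t \<in> N \<Longrightarrow> f t = h t" for f h t
  proof -
    have "pd e 1 (pd e 1 f) t = rpd e N 1 (rpd e N 1 h) t"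
      by (intro agree that)
    then show ?thesis
      using that u[of 1 t] K.g_pos by (simp add: L_op_def K.L_def)
  qed
  have U: "U_op e u k f t = (q * K.U k h) t"
    if t: "t \<in> N" and f: "\<And>t. t \<in> N \<Longrightarrow> f t = h t" and h: "smooth_fun_on N h"
      and k: "k \<in> {1..CARD('n)}" for f h t k
  proof -
    have 1: "pd e 1 (pd e 1 (pd e k f)) t = rpd e N 1 (rpd e N 1 (rpd e N k h)) t"
      by (intro agree t f)
    have 2: "pd e m f t = rpd e N m h t" for m
      by (intro agree t f)
    have prod: "pd e m (\<lambda>s. u n s * f s) t = (rpd e N m (v n) * h + v n * rpd e N m h) t"
      if "n \<in> {1..CARD('n)}" for m n
    proof -
      have "pd e m (\<lambda>s. u n s * f s) t = rpd e N m (v n * h) t"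
        using u[OF that] f by (intro agree t) simp
      then show ?thesis
        using h v by simp
    qed
    \<comment> \<open>By this symmetry the zeroth-order terms with weights 1/2 and 1/4 combine to
      3/4 of one derivative, the coefficient 3 in \<open>K.U\<close>.\<close>
    have "rpd e N k (v 1) = rpd e N 1 (v k)"
      using k K.g_pos by (intro K.flow_symmetric) auto
    then show ?thesis
      using prod[of 1 k] prod[OF k, of 1] K.g_pos u[OF _ t] k
      by (simp add: U_op_def K.U_def q_def 1[unfolded One_nat_def] 2 f[OF t] field_simps)
  qed
  have LC: "smooth_fun_on N (K.L h)" and UC: "smooth_fun_on N (K.U k h)"
    and qUC: "smooth_fun_on N (q * K.U k h)" if "smooth_fun_on N h" for h k
    using that K.L_closed K.U_closed K.mult_closed[OF q(1)] by auto
  show "ops_commute_on N (L_op e u) (U_op e u i)"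
    unfolding ops_commute_on_def
  proof (intro allI impI ballI)
    fix f t
    assume f: "smooth_fun_on N f" and t: "t \<in> N"
    have "L_op e u (U_op e u i f) t = K.L (q * K.U i f) t"
      by (intro L t U i f refl)
    also have "\<dots> = (q * K.L (K.U i f)) t"
      using K.L_const_mult[OF _ q] UC[OF f] by simp
    also have "\<dots> = (q * K.U i (K.L f)) t"
      using K.L_U_commute[OF _ i] f by simp
    also have "\<dots> = U_op e u i (L_op e u f) t"
      by (intro U[symmetric] t L i LC f refl)
    finally show "L_op e u (U_op e u i f) t = U_op e u i (L_op e u f) t" .
  qed
  show "ops_commute_on N (U_op e u i) (U_op e u j)" if j: "j \<in> {1..CARD('n)}"
    unfolding ops_commute_on_def
  proof (intro allI impI ballI)
    fix f t
    assume f: "smooth_fun_on N f" and t: "t \<in> N"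
    have UU: "U_op e u k (U_op e u m f) t = (q * (q * K.U k (K.U m f))) t"
      if k: "k \<in> {1..CARD('n)}" and m: "m \<in> {1..CARD('n)}" for k m
    proof -
      have "U_op e u k (U_op e u m f) t = (q * K.U k (q * K.U m f)) t"
        by (intro U t k m f qUC refl)
      then show ?thesis
        using K.U_const_mult[OF _ q] UC[OF f] by simp
    qed
    show "U_op e u i (U_op e u j f) t = U_op e u j (U_op e u i f) t"
      using UU[OF i j] UU[OF j i] K.U_U_commute[OF _ i j] f by simp
  qed
qed

text \<open>The coefficients of \<open>Q\<close> have vanishing gradient on a ball, hence are
  constants. Dividing by the formal variable gives the Laurent identity.\<close>

lemma first_integral:
  fixes e :: "nat \<Rightarrow> 'n::finite" and u :: "nat \<Rightarrow> 'a::real_normed_field ^ 'n \<Rightarrow> 'a"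
  assumes e: "bij_betw e {1..CARD('n)} UNIV"
    and kdv: "stationary_kdv {f. smooth_fun_on (ball 0 r) f} (rpd e (ball 0 r)) CARD('n) v w"
    and u: "\<And>k t. k \<in> {1..CARD('n)} \<Longrightarrow> t \<in> ball 0 r \<Longrightarrow> u k t = v k t"
  shows "\<exists>\<mu>. \<forall>t\<in>ball 0 r.
      4 * (4 * fls_X_inv + (\<Sum>i=1..2 * CARD('n). fls_const (\<mu> i) * fls_X ^ i)) =
        (gen_fun (\<lambda>i. pd e 1 (u i)) t)\<^sup>2
        + 2 * gen_fun (\<lambda>i. pd e 1 (pd e 1 (u i))) t * (2 - gen_fun u t)
        + 4 * (fls_X_inv + fls_const (u 1 t)) * (2 - gen_fun u t)\<^sup>2"
proof -
  let ?N = "ball 0 r :: ('a ^ 'n) set" and ?g = "CARD('n)"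
  interpret K: stationary_kdv "{f. smooth_fun_on ?N f}" "rpd e ?N" ?g v w
    by (rule kdv)
  interpret F: diff_ring K.Rfps K.dfps
    by (rule K.diff_ring_fps)
  have Q_smooth: "smooth_fun_on ?N (fps_nth K.Q n)" for n
  proof -
    have "K.W \<in> K.Rfps" "fps_X \<in> K.Rfps" "fps_const (v 1) \<in> K.Rfps"
      using K.zero_closed K.w_closed K.v_closed K.one_closed by (auto simp: K.Rfps_def)
    then have "K.Q \<in> K.Rfps"
      by (simp add: K.Q_def power2_eq_square)
    then show ?thesis
      by (simp add: K.Rfps_def)
  qed
  have Q_const: "fps_nth K.Q n t = fps_nth K.Q n 0" if "t \<in> ?N" for n t
  proof (rule zero_partial_derivs_imp_constant[OF smooth_imp_C_k[OF Q_smooth] _ that])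
    fix j and t :: "'a ^ 'n"
    assume t: "t \<in> ?N"
    have "j \<in> e ` {1..?g}"
      using e by (simp add: bij_betw_def)
    then obtain k where k: "k \<in> {1..?g}" "j = e k"
      by auto
    show "partial_deriv j (fps_nth K.Q n) t = 0"
      using fun_cong[OF K.Q_constant[OF k(1), of n], of t] t k by (simp add: rpd_def pd_def)
  qed
  \<comment> \<open>The index shift undoes the extra factor \<open>fps_X\<close> in
    \<open>Q\<close>, and 4 is the factor on the left of the identity.\<close>
  define \<mu> where "\<mu> i = fps_nth K.Q (Suc i) 0 / 4" for i
  show ?thesis
  proof (intro exI ballI)
    fix t
    assume t: "t \<in> ?N"
    let ?w = "\<lambda>F. fps_to_fls (fps_at t F)"
    have pd1: "pd e 1 (u k) t = rpd e ?N 1 (v k) t"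
      and pd2: "pd e 1 (pd e 1 (u k)) t = rpd e ?N 1 (rpd e ?N 1 (v k)) t" if "k \<in> {1..?g}" for k
      using u[OF that] by (intro pd_eq_rpd open_ball t; simp)+
    have W: "?w K.W = 2 - gen_fun u t"
      by (rule fls_eqI) (auto simp: gen_fun_nth K.w_def u[OF _ t] K.v_beyond nat_le_iff)
    have W1: "?w (K.dfps 1 K.W) = - gen_fun (\<lambda>i. pd e 1 (u i)) t"
      using K.v_closed
      by (intro fls_eqI) (auto simp: gen_fun_nth K.w_def pd1[unfolded One_nat_def] K.v_beyond nat_le_iff)
    have W2: "?w (K.dfps 1 (K.dfps 1 K.W)) = - gen_fun (\<lambda>i. pd e 1 (pd e 1 (u i))) t"
      using K.v_closed K.d_closed[OF K.v_closed]
      by (intro fls_eqI) (auto simp: gen_fun_nth K.w_def pd2[unfolded One_nat_def] K.v_beyond nat_le_iff)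
    have wQ: "?w K.Q = fls_X * ((?w (K.dfps 1 K.W))\<^sup>2 - 2 * ?w (K.dfps 1 (K.dfps 1 K.W)) * ?w K.W)
        + 4 * (1 + fls_X * fls_const (v 1 t)) * (?w K.W)\<^sup>2"
      by (simp add: K.Q_def power2_eq_square fls_times_fps_to_fls)
    have "fls_X_inv * ?w K.Q = (fls_X_inv * fls_X) * (gen_fun (\<lambda>i. pd e 1 (u i)) t)\<^sup>2
        + (fls_X_inv * fls_X) * 2 * gen_fun (\<lambda>i. pd e 1 (pd e 1 (u i))) t * (2 - gen_fun u t)
        + 4 * (fls_X_inv + (fls_X_inv * fls_X) * fls_const (v 1 t)) * (2 - gen_fun u t)\<^sup>2"
      unfolding wQ W W1 W2 by (simp add: algebra_simps)
    also have "fls_X_inv * fls_X = (1 :: 'a fls)"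
      by (simp add: fls_X_inv_times_conv_shift)
    also have "v 1 t = u 1 t"
      using u[OF _ t] K.g_pos by simp
    finally have Q: "fls_X_inv * ?w K.Q = (gen_fun (\<lambda>i. pd e 1 (u i)) t)\<^sup>2
        + 2 * gen_fun (\<lambda>i. pd e 1 (pd e 1 (u i))) t * (2 - gen_fun u t)
        + 4 * (fls_X_inv + fls_const (u 1 t)) * (2 - gen_fun u t)\<^sup>2"
      by simp
    have "4 * (4 * fls_X_inv + (\<Sum>i=1..2 * ?g. fls_const (\<mu> i) * fls_X ^ i)) = fls_X_inv * ?w K.Q"
    proof (rule fls_eqI)
      fix n
      have *[unfolded One_nat_def]: "fls_nth (\<Sum>i=1..2 * ?g. fls_const (\<mu> i) * fls_X ^ i) m
          = (if 1 \<le> m \<and> m \<le> 2 * int ?g then \<mu> (nat m) else 0)" for m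
      proof -
        have "fls_nth (\<Sum>i=1..2 * ?g. fls_const (\<mu> i) * fls_X ^ i) m
            = (\<Sum>i=1..2 * ?g. if i = nat m \<and> 0 \<le> m then \<mu> i else 0)"
          unfolding fls_nth_sum by (intro sum.cong) auto
        also have "\<dots> = (if 1 \<le> m \<and> m \<le> 2 * int ?g then \<mu> (nat m) else 0)"
          by (cases "0 \<le> m") auto
        finally show ?thesis .
      qed
      \<comment> \<open>The cases from -1 upwards correspond to \<open>Q_0\<close>,
        \<open>Q_1\<close>, the constants \<open>\<mu>\<close>, and \<open>Q_beyond\<close>.\<close>
      consider "n < -1" | "n = -1" | "n = 0" | "1 \<le> n" "n \<le> 2 * int ?g" | "2 * int ?g < n"
        by linarith
      then show "fls_nth (4 * (4 * fls_X_inv + (\<Sum>i=1..2 * ?g. fls_const (\<mu> i) * fls_X ^ i))) n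
          = fls_nth (fls_X_inv * ?w K.Q) n"
      proof cases
        case 3
        then show ?thesis
          using K.Q_1 by (simp add: * fls_X_inv_times_conv_shift)
      next
        case 4
        then have "nat (n + 1) = Suc (nat n)"
          by simp
        moreover have "4 * \<mu> (nat n) = fps_nth K.Q (Suc (nat n)) t"
          using Q_const[OF t] by (simp add: \<mu>_def)
        ultimately show ?thesis
          using 4 by (simp add: * fls_X_inv_times_conv_shift)
      next
        case 5
        then have "fps_nth K.Q (nat (n + 1)) = 0"
          by (intro K.Q_beyond) auto
        then show ?thesis
          using 5 by (simp add: * fls_X_inv_times_conv_shift)
      qed (simp_all add: * fls_X_inv_times_conv_shift K.Q_0)
    qed
    with Q show "4 * (4 * fls_X_inv + (\<Sum>i=1..2 * ?g. fls_const (\<mu> i) * fls_X ^ i)) =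
        (gen_fun (\<lambda>i. pd e 1 (u i)) t)\<^sup>2
        + 2 * gen_fun (\<lambda>i. pd e 1 (pd e 1 (u i))) t * (2 - gen_fun u t)
        + 4 * (fls_X_inv + fls_const (u 1 t)) * (2 - gen_fun u t)\<^sup>2"
      by simp
  qed
qed

theorem theorem9p1:
  fixes e :: "nat \<Rightarrow> 'n::finite"
    and S :: "('a::{real_normed_field, banach} ^ 'n) set"
    and u1 :: "'a ^ 'n \<Rightarrow> 'a"
  assumes "bij_betw e {1..CARD('n)} UNIV"
    and "open S" and "0 \<in> S"
    and "stationary_gKdV e S u1"
  shows "\<exists>N w l. open N \<and> 0 \<in> N \<and> N \<subseteq> S \<and>
    smooth_fun_on N w \<and> log_branch_on N w l \<and>
    (\<forall>t\<in>N. 2 * pd e 1 (pd e 1 l) t = - u1 t) \<and>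
    w 0 = 1 \<and> (\<forall>k\<in>{1..CARD('n)}. pd e k w 0 = 0) \<and>
    (let u = (\<lambda>k t. - 2 * pd e 1 (pd e k l) t) in
       (\<forall>i\<in>{1..CARD('n)}. ops_commute_on N (L_op e u) (U_op e u i)) \<and>
       (\<forall>i\<in>{1..CARD('n)}. \<forall>j\<in>{1..CARD('n)}. ops_commute_on N (U_op e u i) (U_op e u j)) \<and>
       (\<exists>\<mu> :: nat \<Rightarrow> 'a. \<forall>t\<in>N.
          4 * (4 * fls_X_inv + (\<Sum>i=1..2 * CARD('n). fls_const (\<mu> i) * fls_X ^ i)) =
            (gen_fun (\<lambda>i. pd e 1 (u i)) t)\<^sup>2
            + 2 * gen_fun (\<lambda>i. pd e 1 (pd e 1 (u i))) t * (2 - gen_fun u t)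
            + 4 * (fls_X_inv + fls_const (u 1 t)) * (2 - gen_fun u t)\<^sup>2))"
proof -
  \<comment> \<open>A ball is mapped into itself by every \<open>shrink K s\<close> with
    \<open>s\<close> in \<open>{0..1}\<close>, as the Poincare lemma requires.\<close>
  obtain r where r: "r > 0" "ball 0 r \<subseteq> S"
    using assms(2,3) by (meson openE)
  let ?N = "ball 0 r :: ('a ^ 'n) set" and ?g = "CARD('n)"
  obtain v where u1: "\<And>t. t \<in> ?N \<Longrightarrow> u1 t = v 1 t"
    and kdv: "stationary_kdv {f. smooth_fun_on ?N f} (rpd e ?N) ?g v (\<lambda>i. if i = 0 then 2 else - v i)"
    using stationary_gKdV_imp_stationary_kdv[OF assms(4) open_ball r(2)] by blast
  interpret K: stationary_kdv "{f. smooth_fun_on ?N f}" "rpd e ?N" ?g v "\<lambda>i. if i = 0 then 2 else - v i"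
    by (rule kdv)
  have closed: "pd e i (v k) t = pd e k (v i) t" if "i \<in> {1..?g}" "k \<in> {1..?g}" "t \<in> ?N" for i k t
    using fun_cong[OF K.flow_symmetric[of i k], of t] that by (simp add: rpd_def)
  have v: "smooth_fun_on ?N (v k)" for k
    using K.v_closed[of k] by simp
  obtain l where l: "smooth_fun_on ?N l" "l 0 = 0" "\<And>k. k \<in> {1..?g} \<Longrightarrow> pd e k l 0 = 0"
    and u: "\<And>k t. k \<in> {1..?g} \<Longrightarrow> t \<in> ?N \<Longrightarrow> - 2 * pd e 1 (pd e k l) t = v k t"
    using exists_log_tau[OF assms(1) r(1) v closed] by blast
  \<comment> \<open>Defining \<open>w\<close> as an exponential makes \<open>l\<close> a branch of
    its logarithm, and \<open>l 0 = 0\<close> gives \<open>w 0 = 1\<close>.\<close>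
  define w where "w = (\<lambda>t. exp (l t))"
  have w: "smooth_fun_on ?N w"
    unfolding w_def using l(1) by (intro smooth_exp open_ball)
  have "pd e k w 0 = 0" if "k \<in> {1..?g}" for k
  proof -
    have "has_partial l (e k) 0 0"
      using smooth_has_partial[OF l(1), of 0 "e k"] l(3)[OF that] that r by (simp add: pd_def)
    from has_partial_imp_partial_deriv[OF has_partial_exp[OF this]] show ?thesis
      using that by (simp add: pd_def w_def)
  qed
  moreover have "2 * pd e 1 (pd e 1 l) t = - u1 t" if "t \<in> ?N" for t
    using u[OF _ that, of 1] u1[OF that] K.g_pos by (simp add: minus_equation_iff)
  ultimately show ?thesis
    unfolding Let_def
    using r w l(1,2) operators_commute[OF kdv open_ball u] first_integral[OF assms(1) kdv u]
    by (intro exI[of _ ?N] exI[of _ w] exI[of _ l]) (auto simp: log_branch_on_def w_def)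
qed

end
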